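(* Let $B>0$. The only functions $\psi\in L^2[0,1]$ such that the wavelet system $X_\Psi$ generated by $\Psi=\{\psi\}$ is a tight frame for $L^2(\mathbb R)$ with frame bound $B$ are those proportional to the Haar wavelet, namely $$\psi=\beta\,\big[\chi_{[0,1/2)}-\chi_{[1/2,1)}\big],\qquad \beta\in\mathbb C,\ |\beta|^2=B.$$
   Context: $L^2[0,1]$ is regarded as the subspace of $L^2(\mathbb R)$ of functions supported in $[0,1]$; $\chi_E$ is the characteristic function of $E$. Let $[Tf](x)=f(x-1)$ and $[Df](x)=2^{1/2}f(2x)$ on $L^2(\mathbb R)$. For $\Psi\subset L^2(\mathbb R)$ the wavelet system generated by $\Psi$ is $X_\Psi=\{\psi_{k,j}:=D^kT^j\psi:\ \psi\in\Psi,\ k,j\in\mathbb Z\}$. It is a tight frame for $L^2(\mathbb R)$ with frame bound $B>0$ if $\sum_{\psi\in\Psi}\sum_{k,j\in\mathbb Z}|\langle f,\psi_{k,j}\rangle|^2=B\|f\|^2$ for all $f\in L^2(\mathbb R)$. *)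

theory Defs
  imports "HOL-Analysis.Analysis"
begin

text \<open>
  Elements of \<open>L\<^sup>2(\<real>)\<close> are represented by Lebesgue measurable functions, and equality in
  \<open>L\<^sup>2(\<real>)\<close> by equality almost everywhere.
\<close>

definition L2 :: "(real \<Rightarrow> complex) set" where
  "L2 = {f \<in> borel_measurable lebesgue. integrable lebesgue (\<lambda>x. (cmod (f x))\<^sup>2)}"

definition L2_unit_interval :: "(real \<Rightarrow> complex) set" where
  "L2_unit_interval = {f \<in> L2. AE x in lebesgue. x \<notin> {0..1} \<longrightarrow> f x = 0}"

definition L2_inner :: "(real \<Rightarrow> complex) \<Rightarrow> (real \<Rightarrow> complex) \<Rightarrow> complex" where
  "L2_inner f g = (LINT x|lebesgue. f x * cnj (g x))"

definition L2_norm :: "(real \<Rightarrow> complex) \<Rightarrow> real" where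
  "L2_norm f = sqrt (LINT x|lebesgue. (cmod (f x))\<^sup>2)"

definition translation :: "(real \<Rightarrow> complex) \<Rightarrow> (real \<Rightarrow> complex)" where
  "translation f = (\<lambda>x. f (x - 1))"

definition dilation :: "(real \<Rightarrow> complex) \<Rightarrow> (real \<Rightarrow> complex)" where
  "dilation f = (\<lambda>x. complex_of_real (sqrt 2) * f (2 * x))"

text \<open>Integer powers of a bijective operator.\<close>

definition int_funpow :: "('a \<Rightarrow> 'a) \<Rightarrow> int \<Rightarrow> 'a \<Rightarrow> 'a" where
  "int_funpow F k = (if k \<ge> 0 then F ^^ nat k else inv F ^^ nat (- k))"

definition wavelet :: "(real \<Rightarrow> complex) \<Rightarrow> int \<Rightarrow> int \<Rightarrow> (real \<Rightarrow> complex)" where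
  "wavelet \<psi> k j = int_funpow dilation k (int_funpow translation j \<psi>)"

text \<open>
  The wavelet system is treated as the family of functions \<open>wavelet \<psi> k j\<close> indexed by
  \<open>(\<psi>, k, j)\<close>, so coinciding members are counted with multiplicity.
\<close>

definition wavelet_tight_frame :: "(real \<Rightarrow> complex) set \<Rightarrow> real \<Rightarrow> bool" where
  "wavelet_tight_frame \<Psi> B \<longleftrightarrow> \<Psi> \<subseteq> L2 \<and> B > 0 \<and>
     (\<forall>f\<in>L2. ((\<lambda>(\<psi>, k, j). (cmod (L2_inner f (wavelet \<psi> k j)))\<^sup>2) has_sum B * (L2_norm f)\<^sup>2)
                (\<Psi> \<times> UNIV \<times> UNIV))"

definition haar :: "real \<Rightarrow> complex" where
  "haar x = indicator {0..<1/2} x - indicator {1/2..<1} x"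

lemma bij_translation: "bij translation"
  by (rule o_bij[where g = "\<lambda>f x. f (x + 1)"]) (auto simp: translation_def fun_eq_iff)

lemma bij_dilation: "bij dilation"
  by (rule o_bij[where g = "\<lambda>f x. f (x / 2) / complex_of_real (sqrt 2)"])
     (auto simp: dilation_def fun_eq_iff)

lemma inv_translation: "inv translation f = (\<lambda>x. f (x + 1))"
  by (rule inv_f_eq) (use bij_translation in \<open>auto simp: translation_def bij_def\<close>)

lemma inv_dilation: "inv dilation f = (\<lambda>x. f (x / 2) / complex_of_real (sqrt 2))"
  by (rule inv_f_eq) (use bij_dilation in \<open>auto simp: dilation_def bij_def\<close>)

lemma int_funpow_translation: "int_funpow translation j f = (\<lambda>x. f (x - of_int j))"
proof -
  have p: "(translation ^^ n) f = (\<lambda>x. f (x - of_nat n))" for n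
    by (induction n) (auto simp: translation_def algebra_simps)
  have m: "(inv translation ^^ n) f = (\<lambda>x. f (x + of_nat n))" for n
    by (induction n) (auto simp: inv_translation algebra_simps)
  show ?thesis
    by (auto simp: int_funpow_def p m)
qed

lemma int_funpow_dilation:
  "int_funpow dilation k f = (\<lambda>x. complex_of_real (sqrt 2) powi k * f (2 powi k * x))"
proof -
  have p: "(dilation ^^ n) f = (\<lambda>x. complex_of_real (sqrt 2) ^ n * f (2 ^ n * x))" for n
    by (induction n) (auto simp: dilation_def algebra_simps)
  have m: "(inv dilation ^^ n) f = (\<lambda>x. f (x / 2 ^ n) / complex_of_real (sqrt 2) ^ n)" for n
    by (induction n) (auto simp: inv_dilation field_simps)
  show ?thesis
    by (auto simp: int_funpow_def p m power_int_def field_simps)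
qed

lemma wavelet_eq:
  "wavelet \<psi> k j = (\<lambda>x. complex_of_real (sqrt 2) powi k * \<psi> (2 powi k * x - of_int j))"
  by (simp add: wavelet_def int_funpow_translation int_funpow_dilation)

end

theory Submission imports Defs begin

text \<open>
  Call the wavelets of levels \<open>k < 0\<close> coarse, those of levels \<open>k \<ge> 0\<close> fine, and let \<open>N(f)\<close> be the sum of
  \<open>|\<langle>f, \<psi>\<^sub>k\<^sub>j\<rangle>|\<^sup>2\<close> over the coarse wavelets.

  Let \<open>\<psi>\<close> generate a tight frame with bound B. A unit translation permutes the fine wavelets of each
  level, so the frame identity shows that N is translation invariant (\<open>coarse_energy_translation\<close>).
  Hence the trace of the quadratic form N on functions supported in \<open>[0, 1)\<close> equals its trace on
  functions supported in \<open>[1, 2)\<close>. The second trace is the sum of the integrals of \<open>|\<psi>\<^sub>k\<^sub>j|\<^sup>2\<close> over \<open>[1, 2)\<close>,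
  and after rescaling it is a sum of integrals of \<open>|\<psi>|\<^sup>2\<close> over disjoint dyadic shells. So the trace is at
  most \<open>\<parallel>\<psi>\<parallel>\<^sup>2\<close> (\<open>coarse_mass_one\<close>, \<open>has_sum_coarse_mass_zero\<close>), and \<open>\<parallel>\<psi>\<parallel>\<^sup>2 \<le> B\<close> follows by testing the
  frame identity with \<open>\<psi>\<close>.

  The support condition enters next. A function that is constant on the dyadic intervals of level k
  only sees the mean of \<open>\<psi>\<close> at level k; testing with the indicator of \<open>[0, 1)\<close> shows that this mean is 0.
  The fine wavelets therefore do not see the indicator, so its coarse energy is \<open>N = B\<close>, which already
  exhausts the trace. By Bessel's inequality the Haar function, orthogonal to the indicator, has
  \<open>N = 0\<close>. Of the fine wavelets only \<open>\<psi>\<close> sees the Haar function h, so \<open>|\<langle>h, \<psi>\<rangle>|\<^sup>2 = B \<ge> \<parallel>\<psi>\<parallel>\<^sup>2 \<parallel>h\<parallel>\<^sup>2\<close>. This is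
  equality in the Cauchy-Schwarz inequality, and \<open>\<psi>\<close> is a multiple of h.

  Conversely, the Haar system is a Parseval frame (\<open>haar_Parseval\<close>). By the parallelogram law its
  coefficients of one level measure the energy gained when averages over dyadic intervals are refined
  once. The sum over the levels telescopes. The limits at the two ends are \<open>\<parallel>f\<parallel>\<^sup>2\<close>, because dyadic step
  functions are dense, and 0, because averages over long intervals vanish.
\<close>

section \<open>Square integrable functions on the line\<close>

lemma L2D:
  assumes "f \<in> L2"
  shows "f \<in> borel_measurable lebesgue" "integrable lebesgue (\<lambda>x. (cmod (f x))\<^sup>2)"
  using assms by (auto simp: L2_def)

lemma L2_norm_squared: "(L2_norm f)\<^sup>2 = (LINT x|lebesgue. (cmod (f x))\<^sup>2)"
  by (simp add: L2_norm_def)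

lemma borel_measurable_cnj [measurable (raw)]:
  "f \<in> borel_measurable M \<Longrightarrow> (\<lambda>x. cnj (f x)) \<in> borel_measurable M"
  by (rule borel_measurable_continuous_on[of cnj]) (auto intro: continuous_intros)

lemma L2_bounded_by:
  assumes f: "f \<in> borel_measurable lebesgue" and w: "integrable lebesgue w"
    and le: "\<And>x. (cmod (f x))\<^sup>2 \<le> w x"
  shows "f \<in> L2"
proof -
  note [measurable] = f
  have "integrable lebesgue (\<lambda>x. (cmod (f x))\<^sup>2)"
  proof (rule Bochner_Integration.integrable_bound[OF w])
    show "(\<lambda>x. (cmod (f x))\<^sup>2) \<in> borel_measurable lebesgue" by measurable
    show "AE x in lebesgue. norm ((cmod (f x))\<^sup>2) \<le> norm (w x)"
    proof (rule AE_I2)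
      fix x show "norm ((cmod (f x))\<^sup>2) \<le> norm (w x)"
        using le[of x] zero_le_power2[of "cmod (f x)"] by (simp del: zero_le_power2)
    qed
  qed
  then show ?thesis using f by (simp add: L2_def)
qed

lemma norm_diff_squared_le: "(norm (a - b))\<^sup>2 \<le> 2 * (norm a)\<^sup>2 + 2 * (norm b)\<^sup>2"
  for a b :: "'a :: real_normed_vector"
proof -
  have "(norm (a - b))\<^sup>2 \<le> (norm a + norm b)\<^sup>2"
    by (intro power_mono norm_triangle_ineq4) auto
  also have "\<dots> \<le> 2 * (norm a)\<^sup>2 + 2 * (norm b)\<^sup>2"
    using sum_squares_bound[of "norm a" "norm b"] by (simp add: power2_sum)
  finally show ?thesis .
qed

lemma L2_diff:
  assumes "f \<in> L2" "g \<in> L2"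
  shows "(\<lambda>x. f x - g x) \<in> L2"
proof (rule L2_bounded_by)
  show "integrable lebesgue (\<lambda>x. 2 * (cmod (f x))\<^sup>2 + 2 * (cmod (g x))\<^sup>2)"
    using assms by (intro Bochner_Integration.integrable_add integrable_mult_right L2D)
  show "(\<lambda>x. f x - g x) \<in> borel_measurable lebesgue"
    using L2D(1)[OF assms(1)] L2D(1)[OF assms(2)] by measurable
qed (rule norm_diff_squared_le)

lemma L2_cmult:
  assumes "f \<in> L2"
  shows "(\<lambda>x. c * f x) \<in> L2"
proof (rule L2_bounded_by)
  show "integrable lebesgue (\<lambda>x. (cmod c)\<^sup>2 * (cmod (f x))\<^sup>2)"
    using assms by (intro integrable_mult_right L2D)
  show "(\<lambda>x. c * f x) \<in> borel_measurable lebesgue"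
    using L2D(1)[OF assms(1)] by measurable
qed (simp add: norm_mult power_mult_distrib)

lemma L2_indicator_mult:
  assumes "f \<in> L2" "A \<in> sets lebesgue"
  shows "(\<lambda>x. indicator A x * f x) \<in> L2"
proof (rule L2_bounded_by[OF _ L2D(2)[OF assms(1)]])
  show "(\<lambda>x. indicator A x * f x) \<in> borel_measurable lebesgue"
    using L2D(1)[OF assms(1)] assms(2) by measurable
qed (simp add: indicator_def)

lemma L2_indicator:
  assumes "A \<in> lmeasurable"
  shows "(indicator A :: real \<Rightarrow> complex) \<in> L2"
proof (rule L2_bounded_by)
  show "integrable lebesgue (\<lambda>x. indicator A x :: real)"
    using assms by (simp only: lmeasurable_iff_integrable)
qed (use assms in \<open>auto simp: indicator_def\<close>)

lemma L2_affine:
  assumes "f \<in> L2" "c \<noteq> 0"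
  shows "(\<lambda>x. f (t + c * x)) \<in> L2"
proof -
  have "(\<lambda>x. t + c * x) \<in> lebesgue \<rightarrow>\<^sub>M lebesgue"
    using lebesgue_affine_measurable[where c= "\<lambda>x::real. c"] \<open>c \<noteq> 0\<close> by simp
  then have "(\<lambda>x. f (t + c * x)) \<in> borel_measurable lebesgue"
    using L2D(1)[OF assms(1)] by simp
  then show ?thesis
    using assms lebesgue_integrable_real_affine[OF L2D(2)[OF assms(1)] assms(2), of t]
    by (simp add: L2_def)
qed

lemma L2_inner_integrable:
  assumes "f \<in> L2" "g \<in> L2"
  shows "integrable lebesgue (\<lambda>x. f x * cnj (g x))"
proof (rule Bochner_Integration.integrable_bound)
  show "integrable lebesgue (\<lambda>x. (cmod (f x))\<^sup>2 + (cmod (g x))\<^sup>2)"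
    using assms by (intro Bochner_Integration.integrable_add L2D)
  show "(\<lambda>x. f x * cnj (g x)) \<in> borel_measurable lebesgue"
    using L2D(1)[OF assms(1)] L2D(1)[OF assms(2)] by measurable
  have "cmod a * cmod b \<le> (cmod a)\<^sup>2 + (cmod b)\<^sup>2" for a b
  proof -
    have "2 * (cmod a * cmod b) \<le> (cmod a)\<^sup>2 + (cmod b)\<^sup>2"
      using sum_squares_bound[of "cmod a" "cmod b"] by simp
    moreover have "0 \<le> cmod a * cmod b" by simp
    ultimately show ?thesis by linarith
  qed
  then show "AE x in lebesgue. norm (f x * cnj (g x)) \<le> norm ((cmod (f x))\<^sup>2 + (cmod (g x))\<^sup>2)"
    by (simp add: norm_mult)
qed

lemma L2_inner_commute: "L2_inner g f = cnj (L2_inner f g)"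
proof -
  have "cnj (L2_inner f g) = (LINT x|lebesgue. cnj (f x * cnj (g x)))"
    unfolding L2_inner_def by (rule Bochner_Integration.integral_cnj[symmetric])
  then show ?thesis by (simp add: L2_inner_def mult.commute)
qed

lemma L2_inner_self: "L2_inner f f = of_real ((L2_norm f)\<^sup>2)"
  by (simp add: L2_inner_def L2_norm_squared flip: complex_norm_square of_real_power)

lemma L2_norm_diff_cmult:
  assumes "f \<in> L2" "g \<in> L2"
  shows "(L2_norm (\<lambda>x. f x - c * g x))\<^sup>2 =
    (L2_norm f)\<^sup>2 - 2 * Re (cnj c * L2_inner f g) + (cmod c)\<^sup>2 * (L2_norm g)\<^sup>2"
proof -
  have "(cmod (a - c * b))\<^sup>2 = (cmod a)\<^sup>2 - 2 * Re (cnj c * (a * cnj b)) + (cmod c)\<^sup>2 * (cmod b)\<^sup>2" for a b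
    unfolding cmod_power2 by (simp add: power2_eq_square algebra_simps)
  then have "(L2_norm (\<lambda>x. f x - c * g x))\<^sup>2 = (LINT x|lebesgue. 
      (cmod (f x))\<^sup>2 - 2 * Re (cnj c * (f x * cnj (g x))) + (cmod c)\<^sup>2 * (cmod (g x))\<^sup>2)"
    by (simp add: L2_norm_squared)
  also have "\<dots> = (L2_norm f)\<^sup>2 - (LINT x|lebesgue. 2 * Re (cnj c * (f x * cnj (g x)))) + (cmod c)\<^sup>2 * (L2_norm g)\<^sup>2"
  proof -
    have "integrable lebesgue (\<lambda>x. 2 * Re (cnj c * (f x * cnj (g x))))"
      by (intro integrable_mult_right integrable_Re L2_inner_integrable assms)
    then show ?thesis
      unfolding L2_norm_squared
      using L2D(2)[OF assms(1)] L2D(2)[OF assms(2)] by (simp del: times_complex.sel)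
  qed
  also have "(LINT x|lebesgue. 2 * Re (cnj c * (f x * cnj (g x)))) = 2 * Re (cnj c * L2_inner f g)"
    by (simp only: integral_mult_right_zero L2_inner_def
        integral_Re[OF integrable_mult_right[OF L2_inner_integrable[OF assms]]])
  finally show ?thesis .
qed

lemma L2_norm_zero_iff:
  assumes "f \<in> L2"
  shows "(L2_norm f)\<^sup>2 = 0 \<longleftrightarrow> (AE x in lebesgue. f x = 0)"
  using integral_nonneg_eq_0_iff_AE[OF L2D(2)[OF assms]] by (simp add: L2_norm_squared)

text \<open>
  The squared distance of f on A to the constant c is smallest when c is the mean of f over A,
  and the excess over the minimum is the measure of A times the squared distance of c to the
  mean. Both consequences
  below are used on dyadic intervals: positivity at the mean is the Cauchy-Schwarz inequality,
  and minimality compares averaging with an arbitrary step function.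
\<close>

lemma mean_variance_identity:
  assumes f: "f \<in> L2" and A: "A \<in> lmeasurable" and pos: "measure lebesgue A > 0"
  defines "a \<equiv> LINT x|lebesgue. indicator A x * f x"
  shows "(LINT x|lebesgue. indicator A x * (cmod (f x - c))\<^sup>2) =
    (LINT x|lebesgue. indicator A x * (cmod (f x))\<^sup>2) - (cmod a)\<^sup>2 / measure lebesgue A
      + (cmod (a - c * measure lebesgue A))\<^sup>2 / measure lebesgue A"
proof -
  let ?m = "measure lebesgue A"
  let ?F = "\<lambda>x. indicator A x * f x"
  have A': "A \<in> sets lebesgue" using A by (simp add: fmeasurable_def)
  have "(LINT x|lebesgue. indicator A x * (cmod (f x - c))\<^sup>2) =
      (L2_norm (\<lambda>x. ?F x - c * indicator A x))\<^sup>2"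
    unfolding L2_norm_squared by (intro Bochner_Integration.integral_cong) (auto simp: indicator_def)
  also have "\<dots> = (L2_norm ?F)\<^sup>2 - 2 * Re (cnj c * L2_inner ?F (indicator A))
      + (cmod c)\<^sup>2 * (L2_norm (indicator A))\<^sup>2"
    by (intro L2_norm_diff_cmult L2_indicator_mult L2_indicator f A A')
  also have "(L2_norm (indicator A))\<^sup>2 = (LINT x|lebesgue. indicator A x)"
    unfolding L2_norm_squared by (intro Bochner_Integration.integral_cong) (auto simp: indicator_def)
  also have "\<dots> = ?m"
    using A by (simp add: lmeasure_integral_UNIV)
  also have "L2_inner ?F (indicator A) = a"
    unfolding L2_inner_def a_def
    by (intro Bochner_Integration.integral_cong) (auto simp: indicator_def)
  also have "(L2_norm ?F)\<^sup>2 = (LINT x|lebesgue. indicator A x * (cmod (f x))\<^sup>2)"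
    unfolding L2_norm_squared by (intro Bochner_Integration.integral_cong) (auto simp: indicator_def)
  finally have expand: "(LINT x|lebesgue. indicator A x * (cmod (f x - c))\<^sup>2) =
      (LINT x|lebesgue. indicator A x * (cmod (f x))\<^sup>2) - 2 * Re (cnj c * a) + (cmod c)\<^sup>2 * ?m" .
  have "(cmod (a - c * ?m))\<^sup>2 = (cmod a)\<^sup>2 - 2 * ?m * Re (cnj c * a) + (cmod c)\<^sup>2 * ?m\<^sup>2"
    unfolding cmod_power2 by (simp add: power2_eq_square algebra_simps)
  then have "- 2 * Re (cnj c * a) + (cmod c)\<^sup>2 * ?m = (cmod (a - c * ?m))\<^sup>2 / ?m - (cmod a)\<^sup>2 / ?m"
    using pos by (simp add: field_simps power2_eq_square)
  with expand show ?thesis by linarith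
qed

lemma Cauchy_Schwarz_indicator:
  assumes f: "f \<in> L2" and A: "A \<in> lmeasurable" and pos: "measure lebesgue A > 0"
  shows "(cmod (LINT x|lebesgue. indicator A x * f x))\<^sup>2
    \<le> measure lebesgue A * (LINT x|lebesgue. indicator A x * (cmod (f x))\<^sup>2)"
proof -
  define a where "a = (LINT x|lebesgue. indicator A x * f x)"
  have "0 \<le> (LINT x|lebesgue. indicator A x * (cmod (f x - a / measure lebesgue A))\<^sup>2)"
    by (intro Bochner_Integration.integral_nonneg) auto
  also have "\<dots> = (LINT x|lebesgue. indicator A x * (cmod (f x))\<^sup>2) - (cmod a)\<^sup>2 / measure lebesgue A"
    using mean_variance_identity[OF assms, of "a / measure lebesgue A"] pos by (simp add: a_def)
  finally show ?thesis using pos by (simp add: a_def field_simps)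
qed

lemma indicator_mean_best_approximation:
  assumes f: "f \<in> L2" and A: "A \<in> lmeasurable" and pos: "measure lebesgue A > 0"
  shows "(LINT x|lebesgue. indicator A x * (cmod (f x))\<^sup>2)
      - (cmod (LINT x|lebesgue. indicator A x * f x))\<^sup>2 / measure lebesgue A
    \<le> (LINT x|lebesgue. indicator A x * (cmod (f x - c))\<^sup>2)"
  using mean_variance_identity[OF assms, of c] pos by simp

section \<open>Dyadic cells and the energy of averages\<close>

text \<open>
  The cell is the dyadic interval \<open>[j / 2\<^sup>n, (j + 1) / 2\<^sup>n)\<close>, described through the floor function so
  that the cells of one level partition the line by construction and refinement becomes integer
  division. The level n may be negative.
\<close>

definition cell :: "int \<Rightarrow> int \<Rightarrow> real set" where
  "cell n j = {x. \<lfloor>2 powi n * x\<rfloor> = j}"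

lemma cell_eq_Ico: "cell n j = {of_int j / 2 powi n ..< (of_int j + 1) / 2 powi n}"
  by (auto simp: cell_def floor_eq_iff field_simps)

lemma cell_lmeasurable: "cell n j \<in> lmeasurable"
  by (simp add: cell_eq_Ico bounded_set_imp_lmeasurable)

lemma cell_sets: "cell n j \<in> sets lebesgue"
  using cell_lmeasurable by (rule fmeasurableD)

lemma measure_cell: "measure lebesgue (cell n j) = 1 / 2 powi n"
  by (simp add: cell_eq_Ico divide_right_mono diff_divide_distrib[symmetric])

lemma measure_cell_pos: "measure lebesgue (cell n j) > 0"
  by (simp add: measure_cell)

text \<open>
  Division by a power of two commutes with taking the floor, provided the quotient is rounded down;
  this is why the dyadic intervals are nested.
\<close>

lemma cell_coarser:
  assumes "x \<in> cell n j" "m \<le> n"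
  shows "\<lfloor>2 powi m * x\<rfloor> = j div 2 ^ nat (n - m)"
proof -
  have "2 powi m * x = (2 powi n * x) / of_int (2 ^ nat (n - m))"
    using assms(2) by (simp add: power_int_diff flip: power_int_of_nat)
  also have "\<lfloor>\<dots>\<rfloor> = \<lfloor>2 powi n * x\<rfloor> div 2 ^ nat (n - m)"
    by (rule floor_divide_real_eq_div) simp
  finally show ?thesis
    using assms(1) by (simp add: cell_def)
qed

lemma indicator_cell_split:
  "indicator (cell n j) x = (indicator (cell (n + 1) (2 * j)) x + indicator (cell (n + 1) (2 * j + 1)) x :: 'a :: semiring_1)"
proof -
  have "\<lfloor>2 powi n * x\<rfloor> = \<lfloor>2 powi (n + 1) * x\<rfloor> div 2"
    using cell_coarser[of x "n + 1" "\<lfloor>2 powi (n + 1) * x\<rfloor>" n] by (simp add: cell_def)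
  then show ?thesis
    by (auto simp: indicator_def cell_def)
qed

lemma wavelet_haar:
  "wavelet haar n j x = complex_of_real (sqrt 2) powi n *
     (indicator (cell (n + 1) (2 * j)) x - indicator (cell (n + 1) (2 * j + 1)) x)"
proof -
  have haar: "haar y = indicator {y. \<lfloor>2 * y\<rfloor> = 0} y - indicator {y. \<lfloor>2 * y\<rfloor> = 1} y" for y
    by (auto simp: haar_def indicator_def floor_eq_iff)
  have "\<lfloor>2 * (2 powi n * x - of_int j)\<rfloor> = \<lfloor>2 powi (n + 1) * x\<rfloor> - 2 * j"
    by (simp add: power_int_add algebra_simps flip: floor_diff_of_int)
  then show ?thesis
    by (simp add: wavelet_eq haar cell_def indicator_def)
qed

lemma integrals_over_disjoint_sets:
  fixes F :: "real \<Rightarrow> real"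
  assumes F: "integrable lebesgue F" and nn: "\<And>x. F x \<ge> 0"
    and A: "\<And>i. i \<in> I \<Longrightarrow> A i \<in> sets lebesgue" and disj: "disjoint_family_on A I"
  defines "b \<equiv> \<lambda>i. LINT x|lebesgue. indicator (A i) x * F x"
  shows "b summable_on I" "infsum b I \<le> (LINT x|lebesgue. F x)"
proof -
  have int: "integrable lebesgue (\<lambda>x. indicator (A i) x * F x)" if "i \<in> I" for i
    using integrable_mult_indicator[OF A[OF that] F] by simp
  have nonneg: "b i \<ge> 0" for i
    unfolding b_def using nn by (intro Bochner_Integration.integral_nonneg) auto
  have bound: "sum b J \<le> (LINT x|lebesgue. F x)" if J: "finite J" "J \<subseteq> I" for J
  proof -
    have "sum b J = (LINT x|lebesgue. (\<Sum>i\<in>J. indicator (A i) x * F x))"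
      unfolding b_def using J by (intro Bochner_Integration.integral_sum[symmetric] int) auto
    also have "\<dots> \<le> (LINT x|lebesgue. F x)"
    proof (intro integral_mono Bochner_Integration.integrable_sum int F)
      fix x
      have "(\<Sum>i\<in>J. indicator (A i) x * F x) = indicator (\<Union>i\<in>J. A i) x * F x"
        by (simp only: indicator_UN_disjoint[OF J(1) disjoint_family_on_mono[OF J(2) disj]]
            sum_distrib_right)
      then show "(\<Sum>i\<in>J. indicator (A i) x * F x) \<le> F x"
        using nn by (simp add: indicator_def)
    qed (use J in auto)
    finally show ?thesis .
  qed
  show *: "b summable_on I"
    by (intro nonneg_bounded_partial_sums_imp_summable_on[where C = "LINT x|lebesgue. F x"]
        eventually_finite_subsets_at_top_weakI nonneg bound)
  show "infsum b I \<le> (LINT x|lebesgue. F x)"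
    by (rule infsum_le_finite_sums[OF * bound])
qed

lemma has_sum_cells:
  fixes F :: "real \<Rightarrow> real"
  assumes F: "integrable lebesgue F" and nn: "\<And>x. F x \<ge> 0"
  shows "((\<lambda>j. LINT x|lebesgue. indicator (cell n j) x * F x) has_sum (LINT x|lebesgue. F x)) UNIV"
proof -
  define b where "b j = (LINT x|lebesgue. indicator (cell n j) x * F x)" for j
  have nonneg: "b j \<ge> 0" for j
    unfolding b_def using nn by (intro Bochner_Integration.integral_nonneg) auto
  have "b summable_on UNIV"
    unfolding b_def[abs_def] using F nn
    by (rule integrals_over_disjoint_sets) (auto simp: cell_sets disjoint_family_on_def cell_def)
  then have b: "(b has_sum infsum b UNIV) UNIV" by simp
  have "((\<lambda>i. b (int_decode i)) has_sum infsum b UNIV) UNIV"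
    using has_sum_reindex_bij_betw[OF bij_int_decode, of b] b by simp
  then have "(\<lambda>i. b (int_decode i)) sums infsum b UNIV"
    by (rule has_sum_imp_sums)
  moreover have "(LINT x|lebesgue. F x) = (\<Sum>i. b (int_decode i))"
  proof -
    have UN: "(\<Union>i. cell n (int_decode i)) = UNIV"
      by (auto simp: cell_def) (metis int_encode_inverse)
    have "(LINT x:(\<Union>i. cell n (int_decode i))|lebesgue. F x) =
        (\<Sum>i. LINT x:cell n (int_decode i)|lebesgue. F x)"
      by (rule lebesgue_integral_countable_add)
         (auto simp: cell_sets UN set_integrable_def F, auto simp: cell_def dest: injD[OF inj_int_decode])
    then show ?thesis
      by (simp add: UN b_def set_lebesgue_integral_def)
  qed
  ultimately have "infsum b UNIV = (LINT x|lebesgue. F x)"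
    by (simp add: sums_iff)
  with b show ?thesis by (simp add: b_def[abs_def])
qed

text \<open>
  With \<open>\<phi> = 2\<^bsup>n/2\<^esup> \<chi>\<close> the normalised indicator of the cell, this is \<open>|\<langle>f, \<phi>\<rangle>|\<^sup>2\<close>. Summed over the cells
  of level n it is the squared norm of the projection of f onto the step functions of level n.
\<close>

definition cell_energy :: "(real \<Rightarrow> complex) \<Rightarrow> int \<Rightarrow> int \<Rightarrow> real" where
  "cell_energy f n j = 2 powi n * (cmod (LINT x|lebesgue. indicator (cell n j) x * f x))\<^sup>2"

definition level_energy :: "(real \<Rightarrow> complex) \<Rightarrow> int \<Rightarrow> real" where
  "level_energy f n = (\<Sum>\<^sub>\<infinity>j. cell_energy f n j)"

lemma cnj_indicator: "cnj (indicator A x) = indicator A x"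
  by (simp add: indicator_def)

lemma cell_energy_nonneg: "cell_energy f n j \<ge> 0"
  by (simp add: cell_energy_def)

lemma cell_energy_le:
  assumes "f \<in> L2"
  shows "cell_energy f n j \<le> (LINT x|lebesgue. indicator (cell n j) x * (cmod (f x))\<^sup>2)"
  using Cauchy_Schwarz_indicator[OF assms cell_lmeasurable measure_cell_pos, of n j]
  by (simp add: cell_energy_def measure_cell field_simps)

lemma has_sum_diff_real:
  fixes a b :: "'a \<Rightarrow> real"
  assumes "(a has_sum S) A" "(b has_sum T) A"
  shows "((\<lambda>x. a x - b x) has_sum (S - T)) A"
  using has_sum_add[OF assms(1), of "\<lambda>x. - b x" "- T"] assms(2) by (simp add: has_sum_uminus)

lemma has_sum_le_majorant:
  fixes a b :: "'a \<Rightarrow> real"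
  assumes b: "(b has_sum S) A" and a: "\<And>x. x \<in> A \<Longrightarrow> 0 \<le> a x" "\<And>x. x \<in> A \<Longrightarrow> a x \<le> b x"
  shows "a summable_on A" "infsum a A \<le> S"
proof -
  show *: "a summable_on A"
    by (rule summable_on_comparison_test[OF has_sum_imp_summable[OF b]]) (use a in auto)
  show "infsum a A \<le> S"
    by (rule has_sum_mono[OF has_sum_infsum[OF *] b]) (use a in auto)
qed

lemma
  assumes "f \<in> L2"
  shows has_sum_level_energy: "(cell_energy f n has_sum level_energy f n) UNIV"
    and level_energy_le: "level_energy f n \<le> (L2_norm f)\<^sup>2"
proof -
  note * = has_sum_le_majorant[OF has_sum_cells[OF L2D(2)[OF assms], of n], of "cell_energy f n"]
  show "(cell_energy f n has_sum level_energy f n) UNIV"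
    unfolding level_energy_def using assms
    by (intro has_sum_infsum * cell_energy_nonneg cell_energy_le) auto
  show "level_energy f n \<le> (L2_norm f)\<^sup>2"
    unfolding level_energy_def L2_norm_squared using assms
    by (intro * cell_energy_nonneg cell_energy_le) auto
qed

lemma level_energy_nonneg: "level_energy f n \<ge> 0"
  unfolding level_energy_def by (intro infsum_nonneg cell_energy_nonneg)

text \<open>
  The parallelogram law. On a cell split into two halves with integrals a and b, the average of f
  sees \<open>a + b\<close> and the Haar function sees \<open>a - b\<close>, while \<open>|a + b|\<^sup>2 + |a - b|\<^sup>2 = 2 |a|\<^sup>2 + 2 |b|\<^sup>2\<close> is what
  the averages over the halves see. Hence Haar coefficients measure the energy gained by one
  refinement, and their sum over all levels telescopes.
\<close>

lemma haar_coefficient_energy: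
  assumes f: "f \<in> L2"
  shows "(cmod (L2_inner f (wavelet haar n j)))\<^sup>2 =
    cell_energy f (n + 1) (2 * j) + cell_energy f (n + 1) (2 * j + 1) - cell_energy f n j"
proof -
  define I where "I m i = (LINT x|lebesgue. indicator (cell m i) x * f x)" for m i
  have int: "integrable lebesgue (\<lambda>x. indicator (cell m i) x * f x)" for m i
    using L2_inner_integrable[OF f L2_indicator[OF cell_lmeasurable[of m i]]]
    by (simp add: mult.commute cnj_indicator)
  have "I n j = I (n + 1) (2 * j) + I (n + 1) (2 * j + 1)"
    unfolding I_def indicator_cell_split[of n j] distrib_right
    by (intro Bochner_Integration.integral_add int)
  moreover have "L2_inner f (wavelet haar n j) =
      complex_of_real (sqrt 2) powi n * (I (n + 1) (2 * j) - I (n + 1) (2 * j + 1))"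
  proof -
    have "f x * cnj (wavelet haar n j x) = complex_of_real (sqrt 2) powi n *
        (indicator (cell (n + 1) (2 * j)) x * f x - indicator (cell (n + 1) (2 * j + 1)) x * f x)" for x
      by (simp add: wavelet_haar algebra_simps indicator_def)
    then show ?thesis
      unfolding L2_inner_def I_def
      by (simp only: integral_mult_right_zero Bochner_Integration.integral_diff[OF int int])
  qed
  moreover have "(cmod (complex_of_real (sqrt 2) powi n))\<^sup>2 = 2 powi n"
    by (simp add: norm_power_int power_int_mult power2_eq_square flip: power_int_mult_distrib)
  ultimately have "(cmod (L2_inner f (wavelet haar n j)))\<^sup>2 =
      2 powi n * (cmod (I (n + 1) (2 * j) - I (n + 1) (2 * j + 1)))\<^sup>2"
    and "cell_energy f n j = 2 powi n * (cmod (I (n + 1) (2 * j) + I (n + 1) (2 * j + 1)))\<^sup>2"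
    by (simp_all add: norm_mult power_mult_distrib cell_energy_def flip: I_def)
  moreover have "cell_energy f (n + 1) i = 2 powi n * (2 * (cmod (I (n + 1) i))\<^sup>2)" for i
    by (simp add: cell_energy_def power_int_add flip: I_def)
  moreover have "(cmod (a - b))\<^sup>2 = 2 * (cmod a)\<^sup>2 + 2 * (cmod b)\<^sup>2 - (cmod (a + b))\<^sup>2" for a b
    unfolding cmod_power2 by (simp add: power2_eq_square algebra_simps)
  ultimately show ?thesis
    by (simp add: algebra_simps)
qed

lemma has_sum_int_even_odd:
  fixes a :: "int \<Rightarrow> real"
  assumes a: "(a has_sum S) UNIV" and nn: "\<And>j. a j \<ge> 0"
  shows "((\<lambda>j. a (2 * j) + a (2 * j + 1)) has_sum S) UNIV"
proof -
  have s: "a summable_on X" for X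
    using summable_on_subset_banach[OF has_sum_imp_summable[OF a]] by simp
  have U: "UNIV = range (\<lambda>j::int. 2 * j) \<union> range (\<lambda>j. 2 * j + 1)"
  proof -
    have "x \<in> range (\<lambda>j::int. 2 * j) \<union> range (\<lambda>j. 2 * j + 1)" for x
      by (cases "even x") (auto elim!: evenE oddE)
    then show ?thesis by auto
  qed
  have d: "range (\<lambda>j::int. 2 * j) \<inter> range (\<lambda>j. 2 * j + 1) = {}"
    by auto presburger
  have "infsum a (range (\<lambda>j. 2 * j)) + infsum a (range (\<lambda>j. 2 * j + 1)) = S"
    using infsum_Un_disjoint[OF s s d] a by (simp add: infsumI flip: U)
  moreover have "((\<lambda>j. a (2 * j)) has_sum infsum a (range (\<lambda>j. 2 * j))) UNIV"
    using has_sum_reindex[of "\<lambda>j::int. 2 * j" UNIV a, THEN iffD1, OF _ has_sum_infsum[OF s]]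
    by (simp add: inj_def o_def)
  moreover have "((\<lambda>j. a (2 * j + 1)) has_sum infsum a (range (\<lambda>j. 2 * j + 1))) UNIV"
    using has_sum_reindex[of "\<lambda>j::int. 2 * j + 1" UNIV a, THEN iffD1, OF _ has_sum_infsum[OF s]]
    by (simp add: inj_def o_def)
  ultimately show ?thesis
    using has_sum_add by blast
qed

lemma has_sum_haar_level:
  assumes "f \<in> L2"
  shows "((\<lambda>j. (cmod (L2_inner f (wavelet haar n j)))\<^sup>2) has_sum (level_energy f (n + 1) - level_energy f n)) UNIV"
  unfolding haar_coefficient_energy[OF assms]
  by (intro has_sum_diff_real has_sum_int_even_odd has_sum_level_energy assms cell_energy_nonneg)

text \<open>
  Averaging over cells is the best approximation by step functions of that level, so any step
  function close to f bounds the energy that the averages miss. This reduces the completeness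
  of the Haar system to the density of dyadic step functions.
\<close>

lemma level_energy_defect_le:
  assumes f: "f \<in> L2" and s: "(\<lambda>x. c \<lfloor>2 powi n * x\<rfloor>) \<in> L2"
  shows "(L2_norm f)\<^sup>2 - level_energy f n \<le> (L2_norm (\<lambda>x. f x - c \<lfloor>2 powi n * x\<rfloor>))\<^sup>2"
proof (rule has_sum_mono)
  show "((\<lambda>j. (LINT x|lebesgue. indicator (cell n j) x * (cmod (f x))\<^sup>2) - cell_energy f n j)
      has_sum ((L2_norm f)\<^sup>2 - level_energy f n)) UNIV"
    unfolding L2_norm_squared by (intro has_sum_diff_real has_sum_cells has_sum_level_energy f L2D) auto
  show "((\<lambda>j. LINT x|lebesgue. indicator (cell n j) x * (cmod (f x - c \<lfloor>2 powi n * x\<rfloor>))\<^sup>2)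
      has_sum (L2_norm (\<lambda>x. f x - c \<lfloor>2 powi n * x\<rfloor>))\<^sup>2) UNIV"
    unfolding L2_norm_squared by (intro has_sum_cells L2D L2_diff f s) auto
  fix j
  have "(LINT x|lebesgue. indicator (cell n j) x * (cmod (f x - c \<lfloor>2 powi n * x\<rfloor>))\<^sup>2)
      = (LINT x|lebesgue. indicator (cell n j) x * (cmod (f x - c j))\<^sup>2)"
    by (intro Bochner_Integration.integral_cong) (auto simp: cell_def indicator_def)
  then show "(LINT x|lebesgue. indicator (cell n j) x * (cmod (f x))\<^sup>2) - cell_energy f n j
      \<le> (LINT x|lebesgue. indicator (cell n j) x * (cmod (f x - c \<lfloor>2 powi n * x\<rfloor>))\<^sup>2)"
    using indicator_mean_best_approximation[OF f cell_lmeasurable measure_cell_pos, of n j "c j"]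
    by (simp add: cell_energy_def measure_cell mult.commute)
qed

section \<open>Density of dyadic step functions\<close>

lemma L2_dominated_convergence:
  fixes s :: "nat \<Rightarrow> real \<Rightarrow> complex"
  assumes f: "f \<in> borel_measurable lebesgue" and s: "\<And>i. s i \<in> borel_measurable lebesgue"
    and w: "integrable lebesgue w"
    and lim: "AE x in lebesgue. (\<lambda>i. s i x) \<longlonglongrightarrow> f x"
    and bound: "\<And>i x. (cmod (s i x))\<^sup>2 \<le> w x" "\<And>x. (cmod (f x))\<^sup>2 \<le> w x"
  shows "(\<lambda>i. (L2_norm (\<lambda>x. f x - s i x))\<^sup>2) \<longlonglongrightarrow> 0"
proof -
  note [measurable] = f s
  have "(\<lambda>i. LINT x|lebesgue. (cmod (f x - s i x))\<^sup>2) \<longlonglongrightarrow> (LINT x|(lebesgue :: real measure). 0)"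
  proof (rule integral_dominated_convergence)
    show "integrable lebesgue (\<lambda>x. 4 * w x)"
      using w by (rule integrable_mult_right)
    show "AE x in lebesgue. norm ((cmod (f x - s i x))\<^sup>2) \<le> 4 * w x" for i
    proof (rule AE_I2)
      fix x show "norm ((cmod (f x - s i x))\<^sup>2) \<le> 4 * w x"
        using norm_diff_squared_le[of "f x" "s i x"] bound(1)[of i x] bound(2)[of x] by simp
    qed
    show "AE x in lebesgue. (\<lambda>i. (cmod (f x - s i x))\<^sup>2) \<longlonglongrightarrow> 0"
      using lim
    proof eventually_elim
      case (elim x)
      have "(\<lambda>i. (cmod (f x - s i x))\<^sup>2) \<longlonglongrightarrow> (cmod (f x - f x))\<^sup>2"
        by (intro tendsto_intros elim)
      then show ?case by simp
    qed
  qed simp_all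
  then show ?thesis by (simp add: L2_norm_squared)
qed

definition dyadic_approximable :: "(real \<Rightarrow> complex) \<Rightarrow> bool" where
  "dyadic_approximable f \<longleftrightarrow> (\<forall>\<epsilon>>0. \<exists>n c. (\<lambda>x. c \<lfloor>2 powi n * x\<rfloor>) \<in> L2 \<and>
     (L2_norm (\<lambda>x. f x - c \<lfloor>2 powi n * x\<rfloor>))\<^sup>2 < \<epsilon>)"

lemma L2_norm_diff_le_via:
  assumes "f \<in> L2" "g \<in> L2" "h \<in> L2"
  shows "(L2_norm (\<lambda>x. f x - h x))\<^sup>2 \<le>
    2 * (L2_norm (\<lambda>x. f x - g x))\<^sup>2 + 2 * (L2_norm (\<lambda>x. g x - h x))\<^sup>2"
proof -
  note int = L2D(2)[OF L2_diff[OF assms(1,2)]] L2D(2)[OF L2_diff[OF assms(2,3)]] L2D(2)[OF L2_diff[OF assms(1,3)]]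
  have "(LINT x|lebesgue. (cmod (f x - h x))\<^sup>2) \<le>
      (LINT x|lebesgue. 2 * (cmod (f x - g x))\<^sup>2 + 2 * (cmod (g x - h x))\<^sup>2)"
  proof (intro integral_mono Bochner_Integration.integrable_add integrable_mult_right int)
    fix x
    show "(cmod (f x - h x))\<^sup>2 \<le> 2 * (cmod (f x - g x))\<^sup>2 + 2 * (cmod (g x - h x))\<^sup>2"
      using norm_diff_squared_le[of "f x - g x" "h x - g x"] by (simp add: norm_minus_commute)
  qed
  also have "\<dots> = 2 * (LINT x|lebesgue. (cmod (f x - g x))\<^sup>2) + 2 * (LINT x|lebesgue. (cmod (g x - h x))\<^sup>2)"
    using int by simp
  finally show ?thesis by (simp add: L2_norm_squared)
qed

lemma dyadic_approximable_closed:
  assumes f: "f \<in> L2" and g: "\<And>i. g i \<in> L2" "\<And>i. dyadic_approximable (g i)"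
    and lim: "(\<lambda>i::nat. (L2_norm (\<lambda>x. f x - g i x))\<^sup>2) \<longlonglongrightarrow> 0"
  shows "dyadic_approximable f"
  unfolding dyadic_approximable_def
proof (intro allI impI)
  fix \<epsilon> :: real assume \<epsilon>: "\<epsilon> > 0"
  have "eventually (\<lambda>i. (L2_norm (\<lambda>x. f x - g i x))\<^sup>2 < \<epsilon> / 4) sequentially"
    by (rule order_tendstoD(2)[OF lim]) (use \<epsilon> in simp)
  then obtain i where i: "(L2_norm (\<lambda>x. f x - g i x))\<^sup>2 < \<epsilon> / 4"
    using eventually_happens'[OF sequentially_bot] by blast
  obtain n c where nc: "(\<lambda>x. c \<lfloor>2 powi n * x\<rfloor>) \<in> L2"
      "(L2_norm (\<lambda>x. g i x - c \<lfloor>2 powi n * x\<rfloor>))\<^sup>2 < \<epsilon> / 4"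
    using g(2)[of i] \<epsilon> unfolding dyadic_approximable_def by (meson divide_pos_pos zero_less_numeral)
  have "(L2_norm (\<lambda>x. f x - c \<lfloor>2 powi n * x\<rfloor>))\<^sup>2 < \<epsilon>"
    using L2_norm_diff_le_via[OF f g(1)[of i] nc(1)] i nc(2) by linarith
  with nc(1) show "\<exists>n c. (\<lambda>x. c \<lfloor>2 powi n * x\<rfloor>) \<in> L2 \<and> (L2_norm (\<lambda>x. f x - c \<lfloor>2 powi n * x\<rfloor>))\<^sup>2 < \<epsilon>"
    by blast
qed

lemma tendsto_dyadic_floor: "(\<lambda>i. of_int \<lfloor>2 ^ i * x\<rfloor> / 2 ^ i) \<longlonglongrightarrow> (x :: real)"
proof (rule tendsto_sandwich[of "\<lambda>i. x - (1/2) ^ i" _ _ "\<lambda>i. x"])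
  show "(\<lambda>i. x - (1/2) ^ i) \<longlonglongrightarrow> x"
    using tendsto_diff[OF tendsto_const LIMSEQ_power_zero[of "1/2 :: real"], of x] by simp
  show "\<forall>\<^sub>F i in sequentially. x - (1/2) ^ i \<le> of_int \<lfloor>2 ^ i * x\<rfloor> / 2 ^ i"
  proof (rule always_eventually, rule allI)
    fix i
    have "(2 ^ i * x - 1) / 2 ^ i \<le> of_int \<lfloor>2 ^ i * x\<rfloor> / 2 ^ i"
      by (intro divide_right_mono) (linarith, simp)
    moreover have "(2 ^ i * x - 1) / 2 ^ i = x - (1/2) ^ i"
      by (simp add: diff_divide_distrib power_divide)
    ultimately show "x - (1/2) ^ i \<le> of_int \<lfloor>2 ^ i * x\<rfloor> / 2 ^ i"
      by simp
  qed
  show "\<forall>\<^sub>F i in sequentially. of_int \<lfloor>2 ^ i * x\<rfloor> / 2 ^ i \<le> x"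
    by (rule always_eventually) (auto simp: field_simps)
qed simp

lemma integrable_bounded_box: "integrable lebesgue (\<lambda>x. (C :: real) * indicator {- real K..<real K} x)"
proof -
  have "{- real K..<real K} \<in> lmeasurable" by (intro bounded_set_imp_lmeasurable) auto
  then have "integrable lebesgue (indicator {- real K..<real K} :: real \<Rightarrow> real)"
    by (simp only: lmeasurable_iff_integrable)
  then show ?thesis by (rule integrable_mult_right)
qed

lemma L2_bounded_box:
  assumes "g \<in> borel_measurable lebesgue" "\<And>x. cmod (g x) \<le> C"
  shows "(\<lambda>x. indicator {- real K..<real K} x * g x) \<in> L2"
proof (rule L2_bounded_by)
  show "(\<lambda>x. indicator {- real K..<real K} x * g x) \<in> borel_measurable lebesgue"
    by (intro borel_measurable_times borel_measurable_indicator assms(1)) simp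
  show "integrable lebesgue (\<lambda>x. C\<^sup>2 * indicator {- real K..<real K} x)"
    by (rule integrable_bounded_box)
  show "(cmod (indicator {- real K..<real K} x * g x))\<^sup>2 \<le> C\<^sup>2 * indicator {- real K..<real K} x" for x
    using assms(2)[of x] by (auto simp: indicator_def intro: power_mono)
qed

text \<open>
  The value of g at the left endpoint of the cell containing x converges to \<open>g x\<close> by continuity. The
  cut-off at integer points keeps the approximants constant on cells of every level \<open>i \<ge> 0\<close>.
\<close>

lemma dyadic_approximable_continuous:
  assumes g: "continuous_on UNIV g" and C: "\<And>x. cmod (g x) \<le> C"
  shows "dyadic_approximable (\<lambda>x. indicator {- real K..<real K} x * g x)"
  unfolding dyadic_approximable_def
proof (intro allI impI)
  fix \<epsilon> :: real assume \<epsilon>: "\<epsilon> > 0"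
  define c where "c i j = (if - int K * 2 ^ i \<le> j \<and> j < int K * 2 ^ i then g (of_int j / 2 ^ i) else 0)" for i :: nat and j :: int
  have c: "c i \<lfloor>2 powi int i * x\<rfloor> = indicator {- real K..<real K} x * g (of_int \<lfloor>2 ^ i * x\<rfloor> / 2 ^ i)" for i x
  proof -
    have "- int K * 2 ^ i \<le> \<lfloor>2 ^ i * x\<rfloor> \<longleftrightarrow> - real K \<le> x"
      using mult_le_cancel_right_pos[of "2 ^ i" "- real K" x] by (simp add: le_floor_iff mult.commute)
    moreover have "\<lfloor>2 ^ i * x\<rfloor> < int K * 2 ^ i \<longleftrightarrow> x < real K"
      by (simp add: floor_less_iff field_simps)
    ultimately show ?thesis by (simp add: c_def indicator_def)
  qed
  have meas: "g \<in> borel_measurable lebesgue"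
    using borel_measurable_continuous_onI[OF g] by (intro measurable_completion) simp
  have meas': "(\<lambda>x::real. c i \<lfloor>2 powi int i * x\<rfloor>) \<in> borel_measurable lebesgue" for i
    by (intro measurable_completion) simp
  have L2: "(\<lambda>x. c i \<lfloor>2 powi int i * x\<rfloor>) \<in> L2" for i
  proof (rule L2_bounded_by[OF meas' integrable_bounded_box])
    show "(cmod (c i \<lfloor>2 powi int i * x\<rfloor>))\<^sup>2 \<le> C\<^sup>2 * indicator {- real K..<real K} x" for x
      unfolding c using C by (auto simp: indicator_def intro: power_mono)
  qed
  have "(\<lambda>i. (L2_norm (\<lambda>x. indicator {- real K..<real K} x * g x - c i \<lfloor>2 powi int i * x\<rfloor>))\<^sup>2) \<longlonglongrightarrow> 0"
  proof (rule L2_dominated_convergence)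
    show "integrable lebesgue (\<lambda>x. C\<^sup>2 * indicator {- real K..<real K} x)"
      by (rule integrable_bounded_box)
    show "AE x in lebesgue. (\<lambda>i. c i \<lfloor>2 powi int i * x\<rfloor>) \<longlonglongrightarrow> indicator {- real K..<real K} x * g x"
    proof (rule AE_I2)
      fix x
      have "(\<lambda>i. g (of_int \<lfloor>2 ^ i * x\<rfloor> / 2 ^ i)) \<longlonglongrightarrow> g x"
        by (rule continuous_on_tendsto_compose[OF g tendsto_dyadic_floor]) auto
      then show "(\<lambda>i. c i \<lfloor>2 powi int i * x\<rfloor>) \<longlonglongrightarrow> indicator {- real K..<real K} x * g x"
        unfolding c by (intro tendsto_mult_left)
    qed
    show "(cmod (c i \<lfloor>2 powi int i * x\<rfloor>))\<^sup>2 \<le> C\<^sup>2 * indicator {- real K..<real K} x" for i x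
      unfolding c using C by (auto simp: indicator_def intro: power_mono)
    show "(cmod (indicator {- real K..<real K} x * g x))\<^sup>2 \<le> C\<^sup>2 * indicator {- real K..<real K} x" for x
      using C by (auto simp: indicator_def intro: power_mono)
    show "(\<lambda>x. indicator {- real K..<real K} x * g x) \<in> borel_measurable lebesgue"
      by (rule L2D(1)[OF L2_bounded_box[OF meas C]])
    show "(\<lambda>x::real. c i \<lfloor>2 powi int i * x\<rfloor>) \<in> borel_measurable lebesgue" for i
      by (rule meas')
  qed
  from order_tendstoD(2)[OF this \<epsilon>]
  show "\<exists>n c. (\<lambda>x. c \<lfloor>2 powi n * x\<rfloor>) \<in> L2 \<and>
      (L2_norm (\<lambda>x. indicator {- real K..<real K} x * g x - c \<lfloor>2 powi n * x\<rfloor>))\<^sup>2 < \<epsilon>"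
    using L2 eventually_happens'[OF sequentially_bot] by blast
qed

text \<open>
  The radial retraction of the complex plane onto the disc of radius K. It is continuous, so it
  turns continuous approximants of f into bounded continuous approximants of the clipped f.
\<close>

definition clip :: "real \<Rightarrow> complex \<Rightarrow> complex" where
  "clip K z = of_real (K / max K (cmod z)) * z"

lemma continuous_on_clip: "K > 0 \<Longrightarrow> continuous_on UNIV (clip K)"
  unfolding clip_def by (intro continuous_intros) (auto simp: max_def)

lemma
  assumes "K > 0"
  shows norm_clip_le: "cmod (clip K z) \<le> K" and norm_clip_le_norm: "cmod (clip K z) \<le> cmod z"
  using assms by (auto simp: clip_def norm_mult norm_divide max_def field_simps)

lemma clip_eq: "K > 0 \<Longrightarrow> cmod z \<le> K \<Longrightarrow> clip K z = z"
  by (simp add: clip_def max_def)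

text \<open>
  A Lebesgue measurable f is an almost everywhere limit of continuous functions g. These carry no
  bound, so both f and g are clipped and cut off to a bounded interval; dominated convergence then
  gives convergence in \<open>L\<^sup>2\<close> for each cut-off, and a second time as the cut-off is removed.
\<close>

theorem L2_dyadic_approximable:
  assumes f: "f \<in> L2"
  shows "dyadic_approximable f"
proof -
  obtain N g where N: "negligible N" and g: "\<And>n. continuous_on UNIV (g n)"
      and lim: "\<And>x. x \<notin> N \<Longrightarrow> (\<lambda>n. g n x) \<longlonglongrightarrow> f x"
    using lebesgue_measurable_imp_measurable_on[OF L2D(1)[OF f], of UNIV]
    unfolding measurable_on_def by auto
  have AE: "AE x in lebesgue. x \<notin> N"
    using N by (simp add: negligible_iff_null_sets AE_not_in)
  have clip_meas: "(\<lambda>x. clip (Suc K) (h x)) \<in> borel_measurable lebesgue"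
    if "h \<in> borel_measurable lebesgue" for h and K
    by (rule borel_measurable_continuous_on[OF continuous_on_clip that]) auto
  have g_meas: "g n \<in> borel_measurable lebesgue" for n
    using borel_measurable_continuous_onI[OF g] by (intro measurable_completion) simp
  define B :: "nat \<Rightarrow> real set" where "B K = {- real (Suc K)..<real (Suc K)}" for K
  define F where "F K = (\<lambda>x. indicator (B K) x * clip (Suc K) (f x))" for K
  have F_L2: "F K \<in> L2" for K
    unfolding F_def B_def
    by (rule L2_bounded_box[where C = "Suc K"], rule clip_meas[OF L2D(1)[OF f]], rule norm_clip_le) simp
  have "dyadic_approximable (F K)" for K
  proof (rule dyadic_approximable_closed[OF F_L2])
    let ?g = "\<lambda>i x. indicator (B K) x * clip (Suc K) (g i x)"
    show g_L2: "?g i \<in> L2" for i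
      unfolding B_def
      by (rule L2_bounded_box[where C = "Suc K"], rule clip_meas[OF g_meas], rule norm_clip_le) simp
    show "dyadic_approximable (?g i)" for i
      unfolding B_def
      by (rule dyadic_approximable_continuous[where C = "Suc K"])
         (auto intro!: norm_clip_le continuous_on_compose2[OF continuous_on_clip g])
    show "(\<lambda>i. (L2_norm (\<lambda>x. F K x - ?g i x))\<^sup>2) \<longlonglongrightarrow> 0"
    proof (rule L2_dominated_convergence[OF L2D(1)[OF F_L2] L2D(1)[OF g_L2]])
      show "integrable lebesgue (\<lambda>x. (real (Suc K))\<^sup>2 * indicator (B K) x)"
        unfolding B_def by (rule integrable_bounded_box)
      show "AE x in lebesgue. (\<lambda>i. ?g i x) \<longlonglongrightarrow> F K x"
        using AE
      proof eventually_elim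
        case (elim x)
        show ?case unfolding F_def
          by (intro tendsto_mult_left continuous_on_tendsto_compose[OF continuous_on_clip lim[OF elim]]) auto
      qed
      show "(cmod (?g i x))\<^sup>2 \<le> (real (Suc K))\<^sup>2 * indicator (B K) x" for i x
        using norm_clip_le[of "Suc K" "g i x"] by (auto simp: indicator_def intro!: power_mono)
      show "(cmod (F K x))\<^sup>2 \<le> (real (Suc K))\<^sup>2 * indicator (B K) x" for x
        using norm_clip_le[of "Suc K" "f x"] by (auto simp: F_def indicator_def intro!: power_mono)
    qed
  qed
  then show ?thesis
  proof (rule dyadic_approximable_closed[OF f F_L2])
    show "(\<lambda>K. (L2_norm (\<lambda>x. f x - F K x))\<^sup>2) \<longlonglongrightarrow> 0"
    proof (rule L2_dominated_convergence[OF L2D(1)[OF f] L2D(1)[OF F_L2] L2D(2)[OF f]])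
      show "AE x in lebesgue. (\<lambda>K. F K x) \<longlonglongrightarrow> f x"
      proof (rule AE_I2)
        fix x
        have "F K x = f x" if "nat \<lceil>\<bar>x\<bar>\<rceil> + nat \<lceil>cmod (f x)\<rceil> \<le> K" for K
        proof -
          have "- real (Suc K) < x" "x < real (Suc K)" "cmod (f x) \<le> Suc K" using that by linarith+
          then show ?thesis by (simp add: F_def B_def clip_eq indicator_def)
        qed
        then have "eventually (\<lambda>K. F K x = f x) sequentially"
          unfolding eventually_sequentially by blast
        then show "(\<lambda>K. F K x) \<longlonglongrightarrow> f x" by (rule tendsto_eventually)
      qed
      show "(cmod (F K x))\<^sup>2 \<le> (cmod (f x))\<^sup>2" for K x
        using norm_clip_le_norm[of "Suc K" "f x"] by (auto simp: F_def indicator_def intro!: power_mono)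
    qed simp
  qed
qed

section \<open>The Haar system is a Parseval frame\<close>

lemma level_energy_fine:
  assumes f: "f \<in> L2" and \<epsilon>: "\<epsilon> > 0"
  obtains n where "(L2_norm f)\<^sup>2 - \<epsilon> < level_energy f n"
proof -
  obtain n c where nc: "(\<lambda>x. c \<lfloor>2 powi n * x\<rfloor>) \<in> L2"
      "(L2_norm (\<lambda>x. f x - c \<lfloor>2 powi n * x\<rfloor>))\<^sup>2 < \<epsilon>"
    using L2_dyadic_approximable[OF f] \<epsilon> unfolding dyadic_approximable_def by blast
  show thesis
    using level_energy_defect_le[OF f nc(1)] nc(2) that[of n] by simp
qed

text \<open>
  For integrable f with \<open>L = \<integral>|f|\<close>, the squared integral over one cell is at most L times the integral
  of \<open>|f|\<close> over that cell. The factor \<open>2\<^sup>n\<close> makes the energy vanish at coarse levels.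
\<close>

lemma level_energy_integrable_le:
  assumes f: "f \<in> L2" and int: "integrable lebesgue f"
  shows "level_energy f n \<le> 2 powi n * (LINT x|lebesgue. cmod (f x))\<^sup>2"
proof -
  define L where "L = (LINT x|lebesgue. cmod (f x))"
  have ind_int: "integrable lebesgue (\<lambda>x. indicator (cell n j) x * cmod (f x))" for j
    using integrable_mult_indicator[OF cell_sets[of n j] integrable_norm[OF int]] by simp
  have b: "((\<lambda>j. LINT x|lebesgue. indicator (cell n j) x * cmod (f x)) has_sum L) UNIV"
    unfolding L_def by (rule has_sum_cells) (use int in auto)
  have "((\<lambda>j. 2 powi n * L * (LINT x|lebesgue. indicator (cell n j) x * cmod (f x)))
      has_sum 2 powi n * L * L) UNIV"
    by (rule has_sum_cmult_right[OF b])
  then have "level_energy f n \<le> 2 powi n * L * L"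
  proof (rule has_sum_mono[OF has_sum_level_energy[OF f]])
    fix j
    define b where "b = (LINT x|lebesgue. indicator (cell n j) x * cmod (f x))"
    have "cmod (LINT x|lebesgue. indicator (cell n j) x * f x) \<le> b"
      unfolding b_def
      by (rule order_trans[OF integral_norm_bound])
         (auto intro!: eq_refl Bochner_Integration.integral_cong simp: indicator_def)
    moreover have "b \<le> L"
      unfolding b_def L_def using int
      by (intro integral_mono ind_int integrable_norm) (auto simp: indicator_def)
    moreover have "0 \<le> b" unfolding b_def by (intro Bochner_Integration.integral_nonneg) auto
    ultimately have "(cmod (LINT x|lebesgue. indicator (cell n j) x * f x))\<^sup>2 \<le> L * b"
      unfolding power2_eq_square by (intro mult_mono) auto
    then show "cell_energy f n j \<le> 2 powi n * L * (LINT x|lebesgue. indicator (cell n j) x * cmod (f x))"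
      by (simp add: cell_energy_def mult.assoc flip: b_def)
  qed
  then show ?thesis by (simp add: L_def power2_eq_square mult.assoc)
qed

lemma level_energy_diff_le:
  assumes f: "f \<in> L2" and g: "g \<in> L2"
  shows "level_energy (\<lambda>x. f x - g x) n \<le> 2 * level_energy f n + 2 * level_energy g n"
proof (rule has_sum_mono)
  show "(cell_energy (\<lambda>x. f x - g x) n has_sum level_energy (\<lambda>x. f x - g x) n) UNIV"
    by (intro has_sum_level_energy L2_diff f g)
  show "((\<lambda>j. 2 * cell_energy f n j + 2 * cell_energy g n j)
      has_sum (2 * level_energy f n + 2 * level_energy g n)) UNIV"
    by (intro has_sum_add has_sum_cmult_right has_sum_level_energy f g)
  fix j
  have int: "integrable lebesgue (\<lambda>x. indicator (cell n j) x * h x)" if "h \<in> L2" for h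
    using L2_inner_integrable[OF that L2_indicator[OF cell_lmeasurable[of n j]]]
    by (simp add: mult.commute cnj_indicator)
  have "(LINT x|lebesgue. indicator (cell n j) x * (f x - g x)) =
      (LINT x|lebesgue. indicator (cell n j) x * f x) - (LINT x|lebesgue. indicator (cell n j) x * g x)"
    unfolding right_diff_distrib by (intro Bochner_Integration.integral_diff int f g)
  then have "cell_energy (\<lambda>x. f x - g x) n j \<le> 2 powi n *
      (2 * (cmod (LINT x|lebesgue. indicator (cell n j) x * f x))\<^sup>2
        + 2 * (cmod (LINT x|lebesgue. indicator (cell n j) x * g x))\<^sup>2)"
    unfolding cell_energy_def by (simp only:) (intro mult_left_mono norm_diff_squared_le, simp)
  then show "cell_energy (\<lambda>x. f x - g x) n j \<le> 2 * cell_energy f n j + 2 * cell_energy g n j"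
    by (simp add: cell_energy_def distrib_left mult.left_commute)
qed

text \<open>
  The part of f on a large bounded interval is integrable, so its energy vanishes as the level goes
  to \<open>-\<infinity>\<close>; the remaining part has small norm and hence small energy at every level.
\<close>

lemma level_energy_coarse:
  assumes f: "f \<in> L2" and \<epsilon>: "\<epsilon> > 0"
  obtains n where "level_energy f n < \<epsilon>"
proof -
  define h where "h K = (\<lambda>x. indicator {- real K..<real K} x * f x)" for K
  have h: "h K \<in> L2" for K
    unfolding h_def by (rule L2_indicator_mult[OF f]) simp
  have "(\<lambda>K. (L2_norm (\<lambda>x. f x - h K x))\<^sup>2) \<longlonglongrightarrow> 0"
  proof (rule L2_dominated_convergence[OF L2D(1)[OF f] L2D(1)[OF h] L2D(2)[OF f]])
    show "AE x in lebesgue. (\<lambda>K. h K x) \<longlonglongrightarrow> f x"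
    proof (rule AE_I2)
      fix x
      have "h K x = f x" if "Suc (nat \<lceil>\<bar>x\<bar>\<rceil>) \<le> K" for K
      proof -
        have "- K < x" "x < K" using that by linarith+
        then show ?thesis by (simp add: h_def indicator_def)
      qed
      then have "eventually (\<lambda>K. h K x = f x) sequentially"
        unfolding eventually_sequentially by blast
      then show "(\<lambda>K. h K x) \<longlonglongrightarrow> f x" by (rule tendsto_eventually)
    qed
  qed (auto simp: h_def indicator_def)
  from order_tendstoD(2)[OF this, of "\<epsilon> / 4"]
  have "eventually (\<lambda>K. (L2_norm (\<lambda>x. f x - h K x))\<^sup>2 < \<epsilon> / 4) sequentially"
    using \<epsilon> by simp
  then obtain K where K: "(L2_norm (\<lambda>x. f x - h K x))\<^sup>2 < \<epsilon> / 4"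
    using eventually_happens'[OF sequentially_bot] by blast
  define L where "L = (LINT x|lebesgue. cmod (h K x))"
  have "{- real K..<real K} \<in> lmeasurable" by (intro bounded_set_imp_lmeasurable) auto
  from L2_inner_integrable[OF f L2_indicator[OF this]]
  have int: "integrable lebesgue (h K)"
    by (simp add: h_def mult.commute cnj_indicator)
  have "(\<lambda>i. 2 * L\<^sup>2 * (1/2) ^ i) \<longlonglongrightarrow> 2 * L\<^sup>2 * 0"
    by (intro tendsto_mult_left LIMSEQ_power_zero) simp
  then have "eventually (\<lambda>i. 2 * L\<^sup>2 * (1/2) ^ i < \<epsilon> / 2) sequentially"
    using \<epsilon> by (intro order_tendstoD) auto
  then obtain i where i: "2 * L\<^sup>2 * (1/2) ^ i < \<epsilon> / 2"
    using eventually_happens'[OF sequentially_bot] by blast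
  let ?n = "- int i"
  have "2 * level_energy (h K) ?n \<le> 2 * L\<^sup>2 * (1/2) ^ i"
    using level_energy_integrable_le[OF h int, of ?n]
    by (simp add: L_def power_int_minus power_divide field_simps)
  moreover have "level_energy f ?n \<le> 2 * level_energy (\<lambda>x. f x - h K x) ?n + 2 * level_energy (\<lambda>x. - h K x) ?n"
    using level_energy_diff_le[OF L2_diff[OF f h] L2_cmult[OF h, of "-1"], of K K ?n] by simp
  moreover have "level_energy (\<lambda>x. - h K x) ?n = level_energy (h K) ?n"
    by (simp add: level_energy_def cell_energy_def)
  moreover have "level_energy (\<lambda>x. f x - h K x) ?n \<le> (L2_norm (\<lambda>x. f x - h K x))\<^sup>2"
    by (intro level_energy_le L2_diff f h)
  ultimately have "level_energy f ?n < \<epsilon>"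
    using i K by linarith
  then show thesis by (rule that)
qed

lemma has_sum_nonneg_telescoping:
  fixes E :: "int \<Rightarrow> real"
  assumes mono: "\<And>n. E n \<le> E (n + 1)" and bounds: "\<And>n. 0 \<le> E n" "\<And>n. E n \<le> S"
    and low: "\<And>\<epsilon>. \<epsilon> > 0 \<Longrightarrow> \<exists>n. E n < \<epsilon>" and high: "\<And>\<epsilon>. \<epsilon> > 0 \<Longrightarrow> \<exists>n. S - \<epsilon> < E n"
  shows "((\<lambda>n. E (n + 1) - E n) has_sum S) UNIV"
proof -
  let ?d = "\<lambda>n. E (n + 1) - E n"
  have tele: "sum ?d {m..<m + int k} = E (m + int k) - E m" for m k
  proof (induction k)
    case (Suc k)
    have "{m..<m + int (Suc k)} = insert (m + int k) {m..<m + int k}" by auto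
    then have "sum ?d {m..<m + int (Suc k)} = ?d (m + int k) + sum ?d {m..<m + int k}"
      by simp
    also have "\<dots> = E (m + int k + 1) - E m" using Suc by simp
    also have "m + int k + 1 = m + int (Suc k)" by simp
    finally show ?case .
  qed simp
  have mono': "E m \<le> E n" if "m \<le> n" for m n
    using that
  proof (induction rule: int_ge_induct)
    case (step i)
    then show ?case using mono[of i] by linarith
  qed simp
  have bound: "sum ?d F \<le> S" if "finite F" for F
  proof -
    define b where "b = (\<Sum>x\<in>F. \<bar>x\<bar>)"
    have b: "\<bar>x\<bar> \<le> b" if "x \<in> F" for x
      unfolding b_def using that \<open>finite F\<close> by (intro member_le_sum) auto
    have "F \<subseteq> {- b..<- b + int (nat (2 * b + 1))}"
      using b by force
    then have "sum ?d F \<le> sum ?d {- b..<- b + int (nat (2 * b + 1))}"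
      by (intro sum_mono2) (auto simp: mono)
    also have "\<dots> \<le> S" 
      unfolding tele using bounds(1)[of "- b"] bounds(2)[of "- b + int (nat (2 * b + 1))"] by linarith
    finally show ?thesis .
  qed
  have summ: "?d summable_on UNIV"
    by (intro nonneg_bounded_partial_sums_imp_summable_on[where C = S]
        eventually_finite_subsets_at_top_weakI bound) (auto simp: mono)
  have "infsum ?d UNIV \<le> S"
    by (rule infsum_le_finite_sums[OF summ bound])
  moreover have "S \<le> infsum ?d UNIV + \<epsilon>" if \<epsilon>: "\<epsilon> > 0" for \<epsilon>
  proof -
    obtain m n where m: "E m < \<epsilon> / 2" and n: "S - \<epsilon> / 2 < E n"
      using low[of "\<epsilon> / 2"] high[of "\<epsilon> / 2"] \<epsilon> by auto
    define k where "k = nat (n - m)"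
    have "n \<le> m + int k" by (simp add: k_def)
    then have "S - \<epsilon> \<le> E (m + int k) - E m" using m n mono'[of n "m + int k"] by linarith
    also have "\<dots> \<le> infsum ?d UNIV"
      unfolding tele[symmetric] by (rule finite_sum_le_infsum[OF summ]) (auto simp: mono)
    finally show ?thesis by simp
  qed
  then have "S \<le> infsum ?d UNIV" by (rule field_le_epsilon)
  ultimately show ?thesis using has_sum_infsum[OF summ] by simp
qed

text \<open>
  Level n of the Haar system carries the difference of the level energies at \<open>n + 1\<close> and n. These
  energies increase from 0 to \<open>\<parallel>f\<parallel>\<^sup>2\<close> over all integer levels, so the differences add up to \<open>\<parallel>f\<parallel>\<^sup>2\<close>.
\<close>

theorem haar_Parseval:
  assumes f: "f \<in> L2"
  shows "((\<lambda>(n, j). (cmod (L2_inner f (wavelet haar n j)))\<^sup>2) has_sum (L2_norm f)\<^sup>2) UNIV"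
proof -
  have outer: "((\<lambda>n. level_energy f (n + 1) - level_energy f n) has_sum (L2_norm f)\<^sup>2) UNIV"
  proof (rule has_sum_nonneg_telescoping)
    show "level_energy f n \<le> level_energy f (n + 1)" for n
      using has_sum_nonneg[OF has_sum_haar_level[OF f, of n]] by simp
  qed (use f in \<open>auto intro: level_energy_nonneg level_energy_le elim: level_energy_fine level_energy_coarse\<close>)
  have "((\<lambda>(n, j). (cmod (L2_inner f (wavelet haar n j)))\<^sup>2) has_sum (L2_norm f)\<^sup>2) (UNIV \<times> UNIV)"
  proof (rule has_sum_SigmaI[OF _ outer])
    show "(\<lambda>(n, j). (cmod (L2_inner f (wavelet haar n j)))\<^sup>2) summable_on UNIV \<times> UNIV"
      by (rule summable_on_SigmaI[OF _ has_sum_imp_summable[OF outer]])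
         (use has_sum_haar_level[OF f] in auto)
  qed (use has_sum_haar_level[OF f] in auto)
  then show ?thesis by simp
qed

section \<open>Translation invariance of the coarse energy\<close>

definition wavelet_energy :: "(real \<Rightarrow> complex) \<Rightarrow> (real \<Rightarrow> complex) \<Rightarrow> int \<times> int \<Rightarrow> real" where
  "wavelet_energy \<psi> f = (\<lambda>(k, j). (cmod (L2_inner f (wavelet \<psi> k j)))\<^sup>2)"

lemma wavelet_tight_frame_singleton:
  "wavelet_tight_frame {\<psi>} B \<longleftrightarrow>
    \<psi> \<in> L2 \<and> B > 0 \<and> (\<forall>f\<in>L2. (wavelet_energy \<psi> f has_sum B * (L2_norm f)\<^sup>2) UNIV)"
proof -
  have "bij_betw (Pair \<psi>) (UNIV :: (int \<times> int) set) ({\<psi>} \<times> UNIV \<times> UNIV)"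
    by (rule bij_betwI[where g = snd]) auto
  note * = has_sum_reindex_bij_betw[OF this]
  have "((\<lambda>(\<psi>, k, j). (cmod (L2_inner f (wavelet \<psi> k j)))\<^sup>2) has_sum S) ({\<psi>} \<times> UNIV \<times> UNIV) \<longleftrightarrow>
      (wavelet_energy \<psi> f has_sum S) UNIV" for f S
    using *[of "\<lambda>(\<psi>, k, j). (cmod (L2_inner f (wavelet \<psi> k j)))\<^sup>2" S]
    by (simp add: wavelet_energy_def case_prod_unfold)
  then show ?thesis
    by (simp add: wavelet_tight_frame_def)
qed

lemma wavelet_energy_nonneg: "wavelet_energy \<psi> f p \<ge> 0"
  by (simp add: wavelet_energy_def split: prod.split)

lemma cmod_wavelet_squared:
  "(cmod (wavelet \<psi> k j x))\<^sup>2 = 2 powi k * (cmod (\<psi> (- of_int j + 2 powi k * x)))\<^sup>2"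
proof -
  have "(sqrt 2 powi k)\<^sup>2 = (2 :: real) powi k"
    by (simp add: power2_eq_square flip: power_int_mult_distrib)
  then show ?thesis
    by (simp add: wavelet_eq norm_mult norm_power_int power_mult_distrib algebra_simps)
qed

lemma wavelet_L2: "\<psi> \<in> L2 \<Longrightarrow> wavelet \<psi> k j \<in> L2"
  using L2_cmult[OF L2_affine[of \<psi> "2 powi k" "- of_int j"], of "complex_of_real (sqrt 2) powi k"]
  by (simp add: wavelet_eq algebra_simps)

lemma L2_norm_wavelet: "(L2_norm (wavelet \<psi> k j))\<^sup>2 = (L2_norm \<psi>)\<^sup>2"
  using lebesgue_integral_real_affine[of "2 powi k" "\<lambda>x. (cmod (\<psi> x))\<^sup>2" "- of_int j"]
  by (simp add: L2_norm_squared cmod_wavelet_squared)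

lemma translation_L2: "f \<in> L2 \<Longrightarrow> translation f \<in> L2"
  using L2_affine[of f 1 "-1"] by (simp add: translation_def)

lemma L2_norm_translation: "L2_norm (translation f) = L2_norm f"
  using lebesgue_integral_real_affine[of 1 "\<lambda>x. (cmod (f x))\<^sup>2" "-1"]
  by (simp add: L2_norm_def translation_def)

lemma L2_inner_translation: "L2_inner (translation f) g = L2_inner f (\<lambda>x. g (1 + x))"
  using lebesgue_integral_real_affine[of 1 "\<lambda>x. f (x - 1) * cnj (g x)" 1]
  by (simp add: L2_inner_def translation_def)

text \<open>
  For \<open>k \<ge> 0\<close> the dilated integer lattice contains the integers, so a unit translation permutes the
  wavelets of level k. For \<open>k < 0\<close> this fails, since \<open>2\<^sup>k\<close> is not an integer.
\<close>

lemma wavelet_shift: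
  assumes "k \<ge> 0"
  shows "wavelet \<psi> k j (1 + x) = wavelet \<psi> k (j - 2 ^ nat k) x"
proof -
  have "(2 :: real) powi k = 2 ^ nat k"
    using assms by (simp add: power_int_def)
  then show ?thesis by (simp add: wavelet_eq algebra_simps)
qed

text \<open>
  The wavelets of levels \<open>k \<ge> 0\<close> are permuted by a unit translation, so their share of the energy is
  the same for f and for its translate. The total \<open>B \<parallel>f\<parallel>\<^sup>2\<close> is the same too, and therefore so is the share
  of the coarse levels \<open>k < 0\<close>, although these wavelets are not permuted.
\<close>

lemma coarse_energy_translation:
  assumes frame: "\<And>f. f \<in> L2 \<Longrightarrow> (wavelet_energy \<psi> f has_sum B * (L2_norm f)\<^sup>2) UNIV"
    and f: "f \<in> L2"
  shows "infsum (wavelet_energy \<psi> (translation f)) ({..<0} \<times> UNIV) =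
    infsum (wavelet_energy \<psi> f) ({..<0} \<times> UNIV)"
proof -
  have U: "(UNIV :: (int \<times> int) set) = {..<0} \<times> UNIV \<union> {0..} \<times> UNIV" by auto
  have d: "({..<0} \<times> UNIV) \<inter> ({0..} \<times> UNIV) = ({} :: (int \<times> int) set)" by auto
  have split: "B * (L2_norm g)\<^sup>2 = infsum (wavelet_energy \<psi> g) ({..<0} \<times> UNIV)
      + infsum (wavelet_energy \<psi> g) ({0..} \<times> UNIV)" if g: "g \<in> L2" for g
  proof -
    have s: "wavelet_energy \<psi> g summable_on X" for X
      using summable_on_subset_banach[OF has_sum_imp_summable[OF frame[OF g]]] by simp
    show ?thesis
      using infsum_Un_disjoint[OF s s d] infsumI[OF frame[OF g]] unfolding U[symmetric] by simp
  qed
  have "bij_betw (\<lambda>(k, j). (k, j - 2 ^ nat k)) ({0..} \<times> UNIV) ({0..} \<times> (UNIV :: int set))"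
    by (rule bij_betwI[where g = "\<lambda>(k, j). (k, j + 2 ^ nat k)"]) auto
  from infsum_reindex_bij_betw[OF this, of "wavelet_energy \<psi> f"]
  have "infsum (wavelet_energy \<psi> f) ({0..} \<times> UNIV) =
      infsum (\<lambda>p. wavelet_energy \<psi> f (case p of (k, j) \<Rightarrow> (k, j - 2 ^ nat k))) ({0..} \<times> UNIV)"
    by simp
  also have "\<dots> = infsum (wavelet_energy \<psi> (translation f)) ({0..} \<times> UNIV)"
    by (rule infsum_cong) (auto simp: wavelet_energy_def L2_inner_translation wavelet_shift)
  finally show ?thesis
    using split[OF f] split[OF translation_L2[OF f]] by (simp add: L2_norm_translation)
qed

section \<open>The coarse mass on a unit interval\<close>

text \<open>
  By nonnegativity both double families may be summed in either order. The rows (index i) carry the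
  known equality of sums, the columns (index p) the sums of interest.
\<close>

lemma has_sum_exchange_order:
  fixes a b :: "'i \<Rightarrow> 'p \<Rightarrow> real"
  assumes nn: "\<And>i p. a i p \<ge> 0" "\<And>i p. b i p \<ge> 0"
    and a: "\<And>p. p \<in> P \<Longrightarrow> ((\<lambda>i. a i p) has_sum \<alpha> p) I"
    and b: "\<And>p. p \<in> P \<Longrightarrow> ((\<lambda>i. b i p) has_sum \<beta> p) I"
    and \<beta>: "(\<beta> has_sum s) P"
    and summ: "\<And>i. i \<in> I \<Longrightarrow> a i summable_on P" "\<And>i. i \<in> I \<Longrightarrow> b i summable_on P"
    and eq: "\<And>i. i \<in> I \<Longrightarrow> infsum (a i) P = infsum (b i) P"
  shows "(\<alpha> has_sum s) P"
proof -
  have "(\<lambda>(p, i). b i p) summable_on P \<times> I"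
    by (rule summable_on_SigmaI[OF _ has_sum_imp_summable[OF \<beta>]]) (use nn b in auto)
  then have "((\<lambda>(p, i). b i p) has_sum s) (P \<times> I)"
    by (intro has_sum_SigmaI[OF _ \<beta>]) (use b in auto)
  then have "((\<lambda>(i, p). b i p) has_sum s) (I \<times> P)"
    by (subst (asm) has_sum_swap) simp
  then have "((\<lambda>i. infsum (b i) P) has_sum s) I"
    by (rule has_sum_SigmaD) (use summ in auto)
  then have outer: "((\<lambda>i. infsum (a i) P) has_sum s) I"
    using eq by (simp cong: has_sum_cong)
  have "(\<lambda>(i, p). a i p) summable_on I \<times> P"
    by (rule summable_on_SigmaI[OF _ has_sum_imp_summable[OF outer]]) (use nn summ in auto)
  then have "((\<lambda>(i, p). a i p) has_sum s) (I \<times> P)"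
    by (intro has_sum_SigmaI[OF _ outer]) (use summ in auto)
  then have "((\<lambda>(p, i). a i p) has_sum s) (P \<times> I)"
    by (subst (asm) has_sum_swap) simp
  then show ?thesis
    by (rule has_sum_SigmaD) (use a in auto)
qed

text \<open>
  The squared norm of the restriction of a wavelet to \<open>[a, a + 1)\<close>. Its sum over \<open>k < 0\<close> and all j is the
  trace of the quadratic form given by the coarse energy on functions supported in \<open>[a, a + 1)\<close>.
\<close>

definition local_mass :: "(real \<Rightarrow> complex) \<Rightarrow> real \<Rightarrow> int \<times> int \<Rightarrow> real" where
  "local_mass \<psi> a = (\<lambda>(k, j). LINT x|lebesgue. indicator {a..<a + 1} x * (cmod (wavelet \<psi> k j x))\<^sup>2)"

text \<open>
  The substitution \<open>y = 2\<^sup>k x - j\<close> carries \<open>[1, 2)\<close> to \<open>[2\<^sup>k, 2\<^bsup>k+1\<^esup>) - j\<close>. For \<open>k < 0\<close> these dyadic shells tile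
  \<open>(0, 1)\<close>, and j moves them to different unit intervals, so all of them are disjoint and the masses
  add up to at most \<open>\<parallel>\<psi>\<parallel>\<^sup>2\<close>. On \<open>[0, 1)\<close> the corresponding sets \<open>[0, 2\<^sup>k) - j\<close> overlap, and no such direct
  bound is available.
\<close>

lemma local_mass_one:
  "local_mass \<psi> 1 (k, j) =
    (LINT x|lebesgue. indicator {2 powi k - of_int j..<2 powi (k + 1) - of_int j} x * (cmod (\<psi> x))\<^sup>2)"
proof -
  let ?S = "{2 powi k - of_int j..<2 powi (k + 1) - of_int j} :: real set"
  have "indicator ?S (- of_int j + 2 powi k * x) = (indicator {1..<2} x :: real)" for x
    by (simp add: indicator_def power_int_add)
  then show ?thesis
    using lebesgue_integral_real_affine[of "2 powi k" "\<lambda>x. indicator ?S x * (cmod (\<psi> x))\<^sup>2" "- of_int j"]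
    by (simp add: local_mass_def cmod_wavelet_squared mult.left_commute)
qed

lemma coarse_shells_disjoint:
  "disjoint_family_on (\<lambda>(k, j). {2 powi k - of_int j..<2 powi (k + 1) - of_int j} :: real set) ({..<0} \<times> UNIV)"
proof -
  have "k = k' \<and> j = j'"
    if k: "k < 0" "k' < 0" and x: "2 powi k - of_int j \<le> x" "x < 2 powi (k + 1) - of_int j"
      "2 powi k' - of_int j' \<le> x" "x < 2 powi (k' + 1) - of_int j'" for k j k' j' :: int and x :: real
  proof -
    have le1: "(2 :: real) powi (i + 1) \<le> 1" if "i < 0" for i
      using power_int_increasing[of "i + 1" 0 "2 :: real"] that by simp
    have pos: "(2 :: real) powi i > 0" for i by simp
    have "- of_int j \<le> x" "x < - of_int j + 1" "- of_int j' \<le> x" "x < - of_int j' + 1"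
      using x le1[OF k(1)] le1[OF k(2)] pos[of k] pos[of k'] by linarith+
    then have "\<lfloor>x\<rfloor> = - j" "\<lfloor>x\<rfloor> = - j'"
      by (simp_all add: floor_eq_iff)
    then have j: "j = j'" by simp
    have "\<not> k < k'" 
      using power_int_increasing[of "k + 1" k' "2 :: real"] x j by auto
    moreover have "\<not> k' < k"
      using power_int_increasing[of "k' + 1" k "2 :: real"] x j by auto
    ultimately show ?thesis using j by simp
  qed
  then show ?thesis
    unfolding disjoint_family_on_def by fastforce
qed

lemma coarse_mass_one:
  assumes "\<psi> \<in> L2"
  shows "local_mass \<psi> 1 summable_on {..<0} \<times> UNIV"
    and "infsum (local_mass \<psi> 1) ({..<0} \<times> UNIV) \<le> (L2_norm \<psi>)\<^sup>2"
proof -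
  have eq: "local_mass \<psi> 1 = (\<lambda>p. LINT x|lebesgue. indicator (case p of (k, j) \<Rightarrow>
      {2 powi k - of_int j..<2 powi (k + 1) - of_int j}) x * (cmod (\<psi> x))\<^sup>2)"
    by (auto simp: fun_eq_iff local_mass_one)
  note * = integrals_over_disjoint_sets[OF L2D(2)[OF assms] _ _ coarse_shells_disjoint]
  show "local_mass \<psi> 1 summable_on {..<0} \<times> UNIV"
    unfolding eq by (rule *) auto
  show "infsum (local_mass \<psi> 1) ({..<0} \<times> UNIV) \<le> (L2_norm \<psi>)\<^sup>2"
    unfolding eq L2_norm_squared by (rule *) auto
qed

text \<open>
  The trace of the coarse energy is the same on \<open>[0, 1)\<close> and on \<open>[1, 2)\<close>, because the coarse energy is
  invariant under unit translation. The trace is taken over the frame itself: every restricted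
  wavelet is expanded in the full wavelet system, which reproduces its squared norm up to the
  factor B. The frame elements are cut to \<open>[0, 1)\<close>, the invariance is applied to each of them, and the
  order of summation is exchanged.
\<close>

lemma has_sum_coarse_mass_zero:
  assumes B: "B > 0" and \<psi>: "\<psi> \<in> L2"
    and frame: "\<And>f. f \<in> L2 \<Longrightarrow> (wavelet_energy \<psi> f has_sum B * (L2_norm f)\<^sup>2) UNIV"
  shows "(local_mass \<psi> 0 has_sum infsum (local_mass \<psi> 1) ({..<0} \<times> UNIV)) ({..<0} \<times> UNIV)"
proof -
  let ?P = "{..<0} \<times> UNIV :: (int \<times> int) set"
  define W where "W p = wavelet \<psi> (fst p) (snd p)" for p
  have W: "W p \<in> L2" for p unfolding W_def by (rule wavelet_L2[OF \<psi>])
  have energy: "wavelet_energy \<psi> f p = (cmod (L2_inner f (W p)))\<^sup>2" for f p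
    by (simp add: wavelet_energy_def W_def split: prod.split)
  define cut where "cut f = (\<lambda>x. indicator {0..<1::real} x * f x :: complex)" for f
  have cut: "cut f \<in> L2" if "f \<in> L2" for f
    unfolding cut_def by (rule L2_indicator_mult[OF that]) simp
  have norm_cut: "(L2_norm (cut f))\<^sup>2 = (LINT x|lebesgue. indicator {0..<1} x * (cmod (f x))\<^sup>2)" for f
    unfolding L2_norm_squared cut_def
    by (intro Bochner_Integration.integral_cong) (auto simp: indicator_def)
  define W1 where "W1 p = (\<lambda>x. W p (1 + x))" for p
  have W1: "W1 p \<in> L2" for p
    using L2_affine[OF W[of p], of 1 1] by (simp add: W1_def)
  have mass0: "(L2_norm (cut (W p)))\<^sup>2 = local_mass \<psi> 0 p" for p
    by (simp add: norm_cut local_mass_def W_def split: prod.split)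
  have mass1: "(L2_norm (cut (W1 p)))\<^sup>2 = local_mass \<psi> 1 p" for p
  proof -
    have "indicator {1..<2} (1 + x) = (indicator {0..<1} x :: real)" for x :: real
      by (simp add: indicator_def)
    then show ?thesis
      using lebesgue_integral_real_affine[of 1 "\<lambda>x. indicator {1..<2} x * (cmod (W p x))\<^sup>2" 1]
      by (cases p) (simp add: norm_cut local_mass_def W_def W1_def)
  qed
  let ?a = "\<lambda>i p. wavelet_energy \<psi> (cut (W i)) p"
  let ?b = "\<lambda>i p. wavelet_energy \<psi> (translation (cut (W i))) p"
  \<comment> \<open>Cutting off is self-adjoint, so the roles of test function and wavelet can be interchanged.\<close>
  have swap: "L2_inner (cut f) g = cnj (L2_inner (cut g) f)" for f g
  proof -
    have "L2_inner (cut f) g = L2_inner f (cut g)"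
      unfolding L2_inner_def cut_def
      by (intro Bochner_Integration.integral_cong) (auto simp: indicator_def)
    then show ?thesis by (simp add: L2_inner_commute[of f])
  qed
  have a: "?a i p = wavelet_energy \<psi> (cut (W p)) i" for i p
    unfolding energy by (subst swap) simp
  have b: "?b i p = wavelet_energy \<psi> (cut (W1 p)) i" for i p
  proof -
    have "L2_inner (translation (cut (W i))) (W p) = cnj (L2_inner (cut (W1 p)) (W i))"
      unfolding L2_inner_translation W1_def by (rule swap)
    then show ?thesis by (simp only: energy complex_mod_cnj)
  qed
  have "((\<lambda>p. B * local_mass \<psi> 0 p) has_sum B * infsum (local_mass \<psi> 1) ?P) ?P"
  proof (rule has_sum_exchange_order[of ?a ?b])
    show "((\<lambda>i. ?a i p) has_sum B * local_mass \<psi> 0 p) UNIV" for p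
    proof -
      have "(\<lambda>i. ?a i p) = wavelet_energy \<psi> (cut (W p))" by (rule ext) (rule a)
      then show ?thesis using frame[OF cut[OF W[of p]]] by (simp only: mass0)
    qed
    show "((\<lambda>i. ?b i p) has_sum B * local_mass \<psi> 1 p) UNIV" for p
    proof -
      have "(\<lambda>i. ?b i p) = wavelet_energy \<psi> (cut (W1 p))" by (rule ext) (rule b)
      then show ?thesis using frame[OF cut[OF W1[of p]]] by (simp only: mass1)
    qed
    show "((\<lambda>p. B * local_mass \<psi> 1 p) has_sum B * infsum (local_mass \<psi> 1) ?P) ?P"
      by (intro has_sum_cmult_right has_sum_infsum coarse_mass_one \<psi>)
    show "?a i summable_on ?P" for i
      by (rule summable_on_subset_banach[OF has_sum_imp_summable[OF frame[OF cut[OF W]]]]) simp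
    show "?b i summable_on ?P" for i
      by (rule summable_on_subset_banach[OF has_sum_imp_summable[OF frame[OF translation_L2[OF cut[OF W]]]]]) simp
    show "infsum (?a i) ?P = infsum (?b i) ?P" for i
      by (rule coarse_energy_translation[OF frame cut[OF W], symmetric])
  qed (simp_all add: wavelet_energy_nonneg)
  then show ?thesis
    using B by (simp add: has_sum_cmult_right_iff)
qed

section \<open>Consequences of the support in the unit interval\<close>

lemma AE_neq_point: "AE x in lebesgue. x \<noteq> (a :: real)"
proof -
  have "AE x in lebesgue. x \<notin> {a}" by (rule AE_not_in) (simp add: negligible_iff_null_sets[symmetric])
  then show ?thesis by simp
qed

text \<open>
  The wavelet \<open>\<psi>\<^sub>k\<^sub>j\<close> lives on the cell of level k and index j, so a function that is constant there only
  sees the mean of \<open>\<psi>\<close>.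
\<close>

lemma wavelet_energy_locally_constant:
  assumes \<psi>: "\<psi> \<in> L2" "AE x in lebesgue. x \<notin> {0..1} \<longrightarrow> \<psi> x = 0"
    and f: "f \<in> L2" "\<And>x. x \<in> cell k j \<Longrightarrow> f x = \<gamma>"
  shows "wavelet_energy \<psi> f (k, j) = (cmod \<gamma>)\<^sup>2 * (cmod (LINT x|lebesgue. \<psi> x))\<^sup>2 / 2 powi k"
proof -
  define t where "t = of_int j / (2 powi k :: real)"
  define c where "c = 1 / (2 powi k :: real)"
  define r where "r = complex_of_real (sqrt 2) powi k"
  have c: "c > 0" by (simp add: c_def)
  have rescale: "2 powi k * (t + c * y) - of_int j = y" for y
    by (simp add: t_def c_def field_simps)
  have "L2_inner f (wavelet \<psi> k j) = c *\<^sub>R (LINT y|lebesgue. f (t + c * y) * cnj (r * \<psi> y))"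
    using lebesgue_integral_real_affine[of c "\<lambda>x. f x * cnj (wavelet \<psi> k j x)" t] c
    by (simp add: L2_inner_def wavelet_eq rescale r_def)
  also have "(LINT y|lebesgue. f (t + c * y) * cnj (r * \<psi> y)) = (LINT y|lebesgue. \<gamma> * cnj r * cnj (\<psi> y))"
  proof (rule integral_cong_AE)
    show "(\<lambda>y. f (t + c * y) * cnj (r * \<psi> y)) \<in> borel_measurable lebesgue"
      using c by (intro borel_measurable_integrable L2_inner_integrable L2_affine L2_cmult f \<psi>) auto
    show "(\<lambda>y. \<gamma> * cnj r * cnj (\<psi> y)) \<in> borel_measurable lebesgue"
      using L2D(1)[OF \<psi>(1)] by measurable
    show "AE y in lebesgue. f (t + c * y) * cnj (r * \<psi> y) = \<gamma> * cnj r * cnj (\<psi> y)"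
      using \<psi>(2) AE_neq_point[of 1]
    proof eventually_elim
      case (elim y)
      have "f (t + c * y) = \<gamma>" if "0 \<le> y" "y < 1"
      proof (rule f(2))
        have "2 powi k * (t + c * y) = of_int j + y" using rescale[of y] by simp
        then show "t + c * y \<in> cell k j" using that by (simp add: cell_def floor_eq_iff)
      qed
      then show ?case using elim by (cases "0 \<le> y \<and> y < 1") auto
    qed
  qed
  also have "\<dots> = \<gamma> * cnj r * cnj (LINT y|lebesgue. \<psi> y)"
    by (simp add: Bochner_Integration.integral_cnj)
  finally have "wavelet_energy \<psi> f (k, j) = c\<^sup>2 * (cmod r)\<^sup>2 * ((cmod \<gamma>)\<^sup>2 * (cmod (LINT x|lebesgue. \<psi> x))\<^sup>2)"
    using c by (simp add: wavelet_energy_def norm_mult power_mult_distrib)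
  also have "(cmod r)\<^sup>2 = 2 powi k"
    by (simp add: r_def norm_power_int power2_eq_square flip: power_int_mult_distrib)
  finally show ?thesis by (simp add: c_def power2_eq_square)
qed

text \<open>
  The indicator of \<open>[0, 1)\<close>, written as a cell so that refinement of cells applies to it.
\<close>

definition unit_step :: "real \<Rightarrow> complex" where "unit_step = indicator (cell 0 0)"

lemma unit_step_L2: "unit_step \<in> L2"
  unfolding unit_step_def by (rule L2_indicator[OF cell_lmeasurable])

lemma norm_unit_step: "(L2_norm unit_step)\<^sup>2 = 1"
proof -
  have "(L2_norm unit_step)\<^sup>2 = (LINT x|lebesgue. indicator (cell 0 0) x)"
    unfolding L2_norm_squared unit_step_def
    by (intro Bochner_Integration.integral_cong) (auto simp: indicator_def)
  then show ?thesis by (simp add: lmeasure_integral_UNIV[OF cell_lmeasurable, symmetric] measure_cell)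
qed

lemma unit_step_on_cell:
  assumes "k \<ge> 0" "x \<in> cell k j"
  shows "unit_step x = (if j div 2 ^ nat k = 0 then 1 else 0)"
  using cell_coarser[OF assms(2,1)] by (simp add: unit_step_def cell_def indicator_def)

lemma haar_eq_cells: "haar x = indicator (cell 1 0) x - indicator (cell 1 1) x"
  using wavelet_haar[of 0 0 x] by (simp add: wavelet_eq)

lemma haar_L2: "haar \<in> L2"
proof -
  have eq: "haar = (\<lambda>x. indicator (cell 1 0) x - indicator (cell 1 1) x)"
    by (simp add: fun_eq_iff haar_eq_cells)
  show ?thesis
    unfolding eq by (intro L2_diff L2_indicator cell_lmeasurable)
qed

lemma norm_haar: "(L2_norm haar)\<^sup>2 = 1"
proof -
  have "(L2_norm haar)\<^sup>2 = (L2_norm unit_step)\<^sup>2"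
    unfolding L2_norm_squared unit_step_def
    by (intro Bochner_Integration.integral_cong)
       (auto simp: haar_def indicator_def cell_eq_Ico)
  then show ?thesis by (simp add: norm_unit_step)
qed

lemma haar_on_cell:
  assumes "k \<ge> 1" "x \<in> cell k j"
  shows "haar x = (if j div 2 ^ nat (k - 1) = 0 then 1 else if j div 2 ^ nat (k - 1) = 1 then - 1 else 0)"
  using cell_coarser[OF assms(2,1)] by (simp add: haar_eq_cells cell_def indicator_def)

text \<open>
  Bessel's inequality for the orthonormal pair \<open>\<chi>\<^bsub>[0,1)\<^esub>\<close> and haar. The parallelogram law turns the left side
  into the energy of v at level 1 on the two halves of \<open>[0, 1)\<close>.
\<close>

lemma Bessel_unit_step_haar:
  assumes v: "v \<in> L2"
  shows "(cmod (L2_inner unit_step v))\<^sup>2 + (cmod (L2_inner haar v))\<^sup>2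
    \<le> (LINT x|lebesgue. indicator {0..<1} x * (cmod (v x))\<^sup>2)"
proof -
  have int: "integrable lebesgue (\<lambda>x. indicator (cell m i) x * (cmod (v x))\<^sup>2)" for m i
    using integrable_mult_indicator[OF cell_sets L2D(2)[OF v]] by simp
  have "cell_energy v 0 0 = (cmod (L2_inner v unit_step))\<^sup>2"
    by (simp add: cell_energy_def L2_inner_def unit_step_def cnj_indicator mult.commute)
  moreover have "(cmod (L2_inner v haar))\<^sup>2 = cell_energy v 1 0 + cell_energy v 1 1 - cell_energy v 0 0"
    using haar_coefficient_energy[OF v, of 0 0] by (simp add: wavelet_eq)
  moreover have "cmod (L2_inner f v) = cmod (L2_inner v f)" for f
    by (subst L2_inner_commute) simp
  ultimately have "(cmod (L2_inner unit_step v))\<^sup>2 + (cmod (L2_inner haar v))\<^sup>2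
      = cell_energy v 1 0 + cell_energy v 1 1" by simp
  also have "\<dots> \<le> (LINT x|lebesgue. indicator (cell 1 0) x * (cmod (v x))\<^sup>2)
      + (LINT x|lebesgue. indicator (cell 1 1) x * (cmod (v x))\<^sup>2)"
    by (intro add_mono cell_energy_le v)
  also have "\<dots> = (LINT x|lebesgue. indicator (cell 0 0) x * (cmod (v x))\<^sup>2)"
    using indicator_cell_split[of 0 0, where 'a = real] int by (simp add: distrib_right)
  also have "cell 0 0 = {0..<1}" by (simp add: cell_eq_Ico)
  finally show ?thesis .
qed

text \<open>
  Every level \<open>k \<ge> 0\<close> has \<open>2\<^sup>k\<close> wavelets inside \<open>[0, 1)\<close>, and each contributes \<open>|\<integral>\<psi>|\<^sup>2 / 2\<^sup>k\<close> to the energy of the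
  indicator of \<open>[0, 1)\<close>. The levels thus contribute \<open>|\<integral>\<psi>|\<^sup>2\<close> each, and their sum is finite.
\<close>

lemma tight_frame_generator_mean_zero:
  assumes \<psi>: "\<psi> \<in> L2" "AE x in lebesgue. x \<notin> {0..1} \<longrightarrow> \<psi> x = 0"
    and frame: "\<And>f. f \<in> L2 \<Longrightarrow> (wavelet_energy \<psi> f has_sum B * (L2_norm f)\<^sup>2) UNIV"
  shows "(LINT x|lebesgue. \<psi> x) = 0"
proof -
  define m where "m = (cmod (LINT x|lebesgue. \<psi> x))\<^sup>2"
  have "real K * m \<le> B" for K
  proof -
    let ?F = "SIGMA k:{0..<int K}. {0..<2 ^ nat k}"
    have "(\<Sum>j = 0..<2 ^ nat k. wavelet_energy \<psi> unit_step (k, j)) = m" if "k \<ge> 0" for k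
    proof -
      have "wavelet_energy \<psi> unit_step (k, j) = m / 2 ^ nat k" if "j \<in> {0..<2 ^ nat k}" for j
      proof -
        have "unit_step x = 1" if "x \<in> cell k j" for x
          using unit_step_on_cell[OF \<open>k \<ge> 0\<close> that] \<open>j \<in> _\<close> by simp
        from wavelet_energy_locally_constant[OF \<psi> unit_step_L2 this] show ?thesis
          using \<open>k \<ge> 0\<close> by (simp add: m_def power_int_def)
      qed
      then show ?thesis by simp
    qed
    then have "real K * m = (\<Sum>k = 0..<int K. \<Sum>j = 0..<2 ^ nat k. wavelet_energy \<psi> unit_step (k, j))"
      by simp
    also have "\<dots> = sum (wavelet_energy \<psi> unit_step) ?F"
      by (subst sum.Sigma) auto
    also have "\<dots> \<le> B * (L2_norm unit_step)\<^sup>2"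
      by (rule finite_sum_le_has_sum[OF frame[OF unit_step_L2]]) (auto simp: wavelet_energy_nonneg)
    finally show ?thesis by (simp add: norm_unit_step)
  qed
  then have "\<not> m > 0"
    using reals_Archimedean3[of m] by (meson not_less)
  then have "m = 0" by (simp add: m_def)
  then show ?thesis by (simp add: m_def)
qed

text \<open>
  Testing the frame identity with \<open>\<psi>\<close> itself, and keeping only the coefficient \<open>\<langle>\<psi>, \<psi>\<rangle>\<close>, gives
  \<open>\<parallel>\<psi>\<parallel>\<^sup>4 \<le> B \<parallel>\<psi>\<parallel>\<^sup>2\<close>.
\<close>

lemma tight_frame_generator_norm_le:
  assumes B: "B > 0" and \<psi>: "\<psi> \<in> L2"
    and frame: "\<And>f. f \<in> L2 \<Longrightarrow> (wavelet_energy \<psi> f has_sum B * (L2_norm f)\<^sup>2) UNIV"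
  shows "(L2_norm \<psi>)\<^sup>2 \<le> B"
proof -
  have "wavelet_energy \<psi> \<psi> (0, 0) = (L2_norm \<psi>)\<^sup>2 * (L2_norm \<psi>)\<^sup>2"
    by (simp add: wavelet_energy_def wavelet_eq L2_inner_self norm_power flip: power2_eq_square)
  moreover have "sum (wavelet_energy \<psi> \<psi>) {(0, 0)} \<le> B * (L2_norm \<psi>)\<^sup>2"
    by (rule finite_sum_le_has_sum[OF frame[OF \<psi>]]) (auto simp: wavelet_energy_nonneg)
  ultimately have le: "(L2_norm \<psi>)\<^sup>2 * (L2_norm \<psi>)\<^sup>2 \<le> B * (L2_norm \<psi>)\<^sup>2" by simp
  show ?thesis
  proof (cases "L2_norm \<psi> = 0")
    case False
    then show ?thesis by (intro mult_right_le_imp_le[OF le]) simp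
  qed (use B in simp)
qed

section \<open>Tight frames generated in the unit interval\<close>

theorem tight_frame_generator_haar:
  assumes B: "B > 0" and \<psi>: "\<psi> \<in> L2" "AE x in lebesgue. x \<notin> {0..1} \<longrightarrow> \<psi> x = 0"
    and frame: "\<And>f. f \<in> L2 \<Longrightarrow> (wavelet_energy \<psi> f has_sum B * (L2_norm f)\<^sup>2) UNIV"
  shows "\<exists>\<beta>. (cmod \<beta>)\<^sup>2 = B \<and> (AE x in lebesgue. \<psi> x = \<beta> * haar x)"
proof -
  let ?P = "{..<0} \<times> UNIV :: (int \<times> int) set"
  let ?E1 = "wavelet_energy \<psi> unit_step" and ?Eh = "wavelet_energy \<psi> haar"
  note mean_zero = tight_frame_generator_mean_zero[OF \<psi> frame]
  have flat: "wavelet_energy \<psi> f (k, j) = 0" if "f \<in> L2" "\<And>x. x \<in> cell k j \<Longrightarrow> f x = \<gamma>" for f k j \<gamma>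
    using wavelet_energy_locally_constant[OF \<psi> that] mean_zero by simp
  have E1: "(?E1 has_sum B) ?P"
  proof -
    have "?E1 p = 0" if "p \<in> UNIV - ?P" for p
    proof (cases p)
      case (Pair k j)
      then have "k \<ge> 0" using that by auto
      from flat[OF unit_step_L2 unit_step_on_cell[OF this]] show ?thesis by (simp add: Pair)
    qed
    then have "(?E1 has_sum B) ?P \<longleftrightarrow> (?E1 has_sum B) UNIV"
      by (intro has_sum_cong_neutral) auto
    then show ?thesis using frame[OF unit_step_L2] by (simp add: norm_unit_step)
  qed
  have Eh: "(?Eh has_sum infsum ?Eh ?P) ?P"
    by (intro has_sum_infsum summable_on_subset_banach[OF has_sum_imp_summable[OF frame[OF haar_L2]]]) simp
  \<comment> \<open>The indicator already uses up the whole coarse mass B, which leaves nothing for haar.\<close>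
  have "B + infsum ?Eh ?P \<le> infsum (local_mass \<psi> 1) ?P"
  proof (rule has_sum_mono[OF has_sum_add[OF E1 Eh] has_sum_coarse_mass_zero[OF B \<psi>(1) frame]])
    show "?E1 p + ?Eh p \<le> local_mass \<psi> 0 p" for p
      using Bessel_unit_step_haar[OF wavelet_L2[OF \<psi>(1)]]
      by (cases p) (simp add: wavelet_energy_def local_mass_def)
  qed
  also have "\<dots> \<le> B"
    using coarse_mass_one(2)[OF \<psi>(1)] tight_frame_generator_norm_le[OF B \<psi>(1) frame] by simp
  finally have h0: "infsum ?Eh ?P \<le> 0" by simp
  have coarse: "?Eh p = 0" if "p \<in> ?P" for p
  proof -
    have "sum ?Eh {p} \<le> infsum ?Eh ?P"
      by (rule finite_sum_le_has_sum[OF Eh]) (use that in \<open>auto simp: wavelet_energy_nonneg\<close>)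
    then show ?thesis using h0 wavelet_energy_nonneg[of \<psi> haar p] by simp
  qed
  have rest: "?Eh p = 0" if p: "p \<noteq> (0, 0)" for p
  proof (cases p)
    case (Pair k j)
    consider "k < 0" | "k = 0" "j \<noteq> 0" | "k \<ge> 1" using p Pair by (cases "k < 0"; cases "k = 0") auto
    then show ?thesis
    proof cases
      case 2
      have "haar x = 0" if "x \<in> cell 0 j" for x
        using that 2 by (auto simp: haar_def cell_eq_Ico indicator_def)
      then show ?thesis using flat[OF haar_L2, of k j 0] 2 Pair by simp
    next
      case 3
      from flat[OF haar_L2 haar_on_cell[OF this]] show ?thesis by (simp add: Pair)
    qed (use coarse Pair in auto)
  qed
  \<comment> \<open>Only \<open>\<psi>\<close> itself can see haar, so \<open>|\<langle>haar, \<psi>\<rangle>|\<^sup>2 = B \<ge> \<parallel>\<psi>\<parallel>\<^sup>2\<close>,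
      and equality in the Cauchy-Schwarz inequality makes the two proportional.\<close>
  have "(?Eh has_sum ?Eh (0, 0)) UNIV \<longleftrightarrow> (?Eh has_sum ?Eh (0, 0)) {(0, 0)}"
    by (intro has_sum_cong_neutral) (auto simp: rest)
  then have "(?Eh has_sum ?Eh (0, 0)) UNIV"
    using has_sum_finite[of "{(0, 0)}" ?Eh] by simp
  then have "?Eh (0, 0) = B"
    using has_sum_unique frame[OF haar_L2] by (fastforce simp: norm_haar)
  define \<beta> where "\<beta> = L2_inner \<psi> haar"
  have \<beta>: "(cmod \<beta>)\<^sup>2 = B"
    using \<open>?Eh (0, 0) = B\<close> L2_inner_commute[of \<psi> haar]
    by (simp add: \<beta>_def wavelet_energy_def wavelet_eq)
  have L2: "(\<lambda>x. \<psi> x - \<beta> * haar x) \<in> L2"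
    by (intro L2_diff L2_cmult \<psi> haar_L2)
  have "Re (cnj \<beta> * L2_inner \<psi> haar) = B"
    using \<beta> unfolding cmod_power2 by (simp add: \<beta>_def[symmetric] power2_eq_square)
  then have "(L2_norm (\<lambda>x. \<psi> x - \<beta> * haar x))\<^sup>2 = (L2_norm \<psi>)\<^sup>2 - B"
    by (simp add: L2_norm_diff_cmult[OF \<psi>(1) haar_L2] norm_haar \<beta>)
  then have "(L2_norm (\<lambda>x. \<psi> x - \<beta> * haar x))\<^sup>2 \<le> 0"
    using tight_frame_generator_norm_le[OF B \<psi>(1) frame] by simp
  then have "(L2_norm (\<lambda>x. \<psi> x - \<beta> * haar x))\<^sup>2 = 0"
    by (rule antisym) simp
  then have "AE x in lebesgue. \<psi> x = \<beta> * haar x"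
    unfolding L2_norm_zero_iff[OF L2] by simp
  with \<beta> show ?thesis by blast
qed

lemma haar_multiple_tight_frame:
  assumes \<psi>: "\<psi> \<in> L2" "AE x in lebesgue. \<psi> x = \<beta> * haar x" and f: "f \<in> L2"
  shows "(wavelet_energy \<psi> f has_sum (cmod \<beta>)\<^sup>2 * (L2_norm f)\<^sup>2) UNIV"
proof -
  have "L2_inner f (wavelet \<psi> k j) = cnj \<beta> * L2_inner f (wavelet haar k j)" for k j
  proof -
    define D where "D x = \<psi> x - \<beta> * haar x" for x
    have D: "D \<in> L2" unfolding D_def[abs_def] by (intro L2_diff L2_cmult \<psi> haar_L2)
    have "AE x in lebesgue. D x = 0"
      using \<psi>(2) by eventually_elim (simp add: D_def)
    then have "AE x in lebesgue. wavelet D k j x = 0"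
      using L2_norm_zero_iff[OF D] L2_norm_zero_iff[OF wavelet_L2[OF D]] by (simp add: L2_norm_wavelet)
    then have AE: "AE x in lebesgue. wavelet \<psi> k j x = \<beta> * wavelet haar k j x"
      by eventually_elim (simp add: wavelet_eq D_def algebra_simps)
    have "L2_inner f (wavelet \<psi> k j) = (LINT x|lebesgue. cnj \<beta> * (f x * cnj (wavelet haar k j x)))"
      unfolding L2_inner_def
    proof (rule integral_cong_AE)
      show "AE x in lebesgue. f x * cnj (wavelet \<psi> k j x) = cnj \<beta> * (f x * cnj (wavelet haar k j x))"
        using AE by eventually_elim simp
    qed (intro borel_measurable_integrable integrable_mult_right L2_inner_integrable wavelet_L2 f \<psi> haar_L2)+
    then show ?thesis by (simp add: L2_inner_def)
  qed
  then have "wavelet_energy \<psi> f = (\<lambda>p. (cmod \<beta>)\<^sup>2 * wavelet_energy haar f p)"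
    by (auto simp: wavelet_energy_def norm_mult power_mult_distrib)
  then show ?thesis
    using haar_Parseval[OF f] by (simp add: has_sum_cmult_right wavelet_energy_def)
qed

theorem corollary3p6:
  fixes B :: real and \<psi> :: "real \<Rightarrow> complex"
  assumes "B > 0"
  shows "(\<psi> \<in> L2_unit_interval \<and> wavelet_tight_frame {\<psi>} B) \<longleftrightarrow>
    (\<exists>\<beta>::complex. (cmod \<beta>)\<^sup>2 = B \<and> (AE x in lebesgue. \<psi> x = \<beta> * haar x))"
proof
  assume "\<psi> \<in> L2_unit_interval \<and> wavelet_tight_frame {\<psi>} B"
  then show "\<exists>\<beta>. (cmod \<beta>)\<^sup>2 = B \<and> (AE x in lebesgue. \<psi> x = \<beta> * haar x)"
    by (intro tight_frame_generator_haar assms) (auto simp: L2_unit_interval_def wavelet_tight_frame_singleton)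
next
  assume "\<exists>\<beta>. (cmod \<beta>)\<^sup>2 = B \<and> (AE x in lebesgue. \<psi> x = \<beta> * haar x)"
  then obtain \<beta> where \<beta>: "(cmod \<beta>)\<^sup>2 = B" and AE: "AE x in lebesgue. \<psi> x = \<beta> * haar x"
    by blast
  have h: "(\<lambda>x. \<beta> * haar x) \<in> L2" by (intro L2_cmult haar_L2)
  from AE obtain N where N: "N \<in> null_sets lebesgue" "{x. \<psi> x \<noteq> \<beta> * haar x} \<subseteq> N"
    by (auto simp: eventually_ae_filter)
  have "(\<lambda>x. \<beta> * haar x) measurable_on UNIV"
    by (intro lebesgue_measurable_imp_measurable_on L2D(1)[OF h]) simp
  then have "\<psi> measurable_on UNIV"
    by (rule measurable_on_spike[where S = N]) (use N in \<open>auto simp: negligible_iff_null_sets\<close>)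
  then have meas: "\<psi> \<in> borel_measurable lebesgue"
    by (rule measurable_on_imp_borel_measurable_lebesgue_UNIV)
  have "integrable lebesgue (\<lambda>x. (cmod (\<psi> x))\<^sup>2)"
  proof (rule integrable_cong_AE_imp[OF L2D(2)[OF h]])
    show "(\<lambda>x. (cmod (\<psi> x))\<^sup>2) \<in> borel_measurable lebesgue"
      using meas by measurable
    show "AE x in lebesgue. (cmod (\<beta> * haar x))\<^sup>2 = (cmod (\<psi> x))\<^sup>2"
      using AE by eventually_elim simp
  qed
  with meas have \<psi>: "\<psi> \<in> L2" by (simp add: L2_def)
  have "AE x in lebesgue. x \<notin> {0..1} \<longrightarrow> \<psi> x = 0"
    using AE by eventually_elim (auto simp: haar_def indicator_def)
  with \<psi> have "\<psi> \<in> L2_unit_interval" by (simp add: L2_unit_interval_def)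
  moreover have "wavelet_tight_frame {\<psi>} B"
    using haar_multiple_tight_frame[OF \<psi> AE] \<psi> assms \<beta> by (simp add: wavelet_tight_frame_singleton)
  ultimately show "\<psi> \<in> L2_unit_interval \<and> wavelet_tight_frame {\<psi>} B" ..
qed

end
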